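(* The second Basilica group $B$ of the Grigorchuk--Erschler group is saturated, and hence $\mathrm{Aut}\,B=N_{\mathrm{Aut}\,T}(B)$.
   Context: Let $T$ be the binary rooted tree with vertices the finite words over $X=\{0,1\}$ (root the empty word, each $v$ joined to $v0,v1$), and $\mathrm{Aut}\,T$ its group of root-fixing automorphisms, acting on the left. The section $g|_v$ of $g\in\mathrm{Aut}\,T$ at a vertex $v$ is defined by $g(vw)=g(v)g|_v(w)$. One writes $g=(g|_0,g|_1)\sigma$ with $\sigma\in\mathrm{Sym}(\{0,1\})$ the action on the first level; $(x,y)$ denotes the automorphism fixing $0,1$ with sections $x$ at $0$ and $y$ at $1$; $\tau$ is the transposition of $0$ and $1$. The second Basilica group $B$ of the Grigorchuk--Erschler group is the subgroup of $\mathrm{Aut}\,T$ generated by $a=(1,1)\tau$, $\alpha=(a,1)$, $c_0=(c_1,1)$, $c_1=(c_2,1)$, $c_2=(c_3,1)$, $c_3=(c_0,\alpha)$. $\mathrm{St}_G(n)$ is the subgroup of $G\le\mathrm{Aut}\,T$ of elements fixing every word of length $n$. A group $G\le\mathrm{Aut}\,T$ is saturated if for every $n\in\mathbb{N}$ there is a subgroup $H_n\le\mathrm{St}_G(n)$ that is characteristic in $G$ and acts spherically transitively on every $n$th level subtree, i.e. for every $v\in X^n$ and every $m\ge 0$, $H_n$ acts transitively on $\{vw\mid w\in X^m\}$. The equality $\mathrm{Aut}\,B=N_{\mathrm{Aut}\,T}(B)$ means that the homomorphism $N_{\mathrm{Aut}\,T}(B)\to\mathrm{Aut}\,B$ given by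 conjugation is an isomorphism, where $N_{\mathrm{Aut}\,T}(B)$ is the normaliser of $B$ in $\mathrm{Aut}\,T$. *)

theory Defs
  imports "HOL-Algebra.Generated_Groups" "HOL-Algebra.Group_Action" "HOL-Algebra.Bij"
begin

section \<open>The binary rooted tree and its automorphism group\<close>

text \<open>Vertices are the finite words over \<^typ>\<open>bool\<close>; the letter 0 is \<^const>\<open>False\<close>, the letter 1
  is \<^const>\<open>True\<close>, and the root is \<^term>\<open>[]\<close>.\<close>

type_synonym vertex = "bool list"

definition tree_adj :: "vertex \<Rightarrow> vertex \<Rightarrow> bool" where
  "tree_adj u v \<longleftrightarrow> (\<exists>x. v = u @ [x]) \<or> (\<exists>x. u = v @ [x])"

definition tree_auts :: "(vertex \<Rightarrow> vertex) set" where
  "tree_auts = {g. bij g \<and> g [] = [] \<and> (\<forall>u v. tree_adj (g u) (g v) \<longleftrightarrow> tree_adj u v)}"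

text \<open>Automorphisms act on the left, so the product \<open>g h\<close> is \<open>g \<circ> h\<close>.\<close>

definition AutT :: "(vertex \<Rightarrow> vertex) monoid" where
  "AutT = \<lparr>carrier = tree_auts, mult = (\<circ>), one = id\<rparr>"

text \<open>The restriction of \<^const>\<open>AutT\<close> to a subset; it is a group if \<open>G\<close> is a subgroup.\<close>

abbreviation as_group :: "(vertex \<Rightarrow> vertex) set \<Rightarrow> (vertex \<Rightarrow> vertex) monoid" where
  "as_group G \<equiv> AutT\<lparr>carrier := G\<rparr>"

lemma tree_aut_extends:
  assumes "g \<in> tree_auts"
  shows "\<exists>y. g (u @ [x]) = g u @ [y]"
proof (induction u arbitrary: x rule: rev_induct)
  case Nil
  have "tree_adj [] [x]" by (simp add: tree_adj_def)
  then have "tree_adj (g []) (g [x])"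
    using assms unfolding tree_auts_def by blast
  moreover have "g [] = []" using assms by (simp add: tree_auts_def)
  ultimately show ?case by (auto simp: tree_adj_def)
next
  case (snoc z u)
  have "tree_adj (u @ [z]) ((u @ [z]) @ [x])" by (simp add: tree_adj_def)
  then have "tree_adj (g (u @ [z])) (g ((u @ [z]) @ [x]))"
    using assms by (simp add: tree_auts_def)
  moreover have "g (u @ [z]) \<noteq> g ((u @ [z]) @ [x]) @ [y]" for y
  proof
    assume "g (u @ [z]) = g ((u @ [z]) @ [x]) @ [y]"
    moreover obtain y' where "g (u @ [z]) = g u @ [y']" using snoc by blast
    ultimately have "g ((u @ [z]) @ [x]) = g u" by simp
    then have "(u @ [z]) @ [x] = u"
      using assms by (auto simp: tree_auts_def dest: bij_is_inj injD)
    then show False by simp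
  qed
  ultimately show ?case by (auto simp: tree_adj_def)
qed

lemma tree_aut_length:
  assumes "g \<in> tree_auts"
  shows "length (g u) = length u"
proof (induction u rule: rev_induct)
  case Nil
  then show ?case using assms by (simp add: tree_auts_def)
next
  case (snoc x u)
  then show ?case using tree_aut_extends[OF assms, of u x] by auto
qed

text \<open>The section of \<open>g\<close> at \<open>v\<close>, characterised for automorphisms by \<open>tree_section_eq\<close>.\<close>

definition tree_section :: "(vertex \<Rightarrow> vertex) \<Rightarrow> vertex \<Rightarrow> vertex \<Rightarrow> vertex" where
  "tree_section g v = (\<lambda>w. drop (length v) (g (v @ w)))"

lemma tree_section_eq:
  assumes "g \<in> tree_auts"
  shows "g (v @ w) = g v @ tree_section g v w"
proof -
  have "\<exists>w'. g (v @ w) = g v @ w'"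
  proof (induction w rule: rev_induct)
    case (snoc x w)
    then show ?case using tree_aut_extends[OF assms, of "v @ w" x] by auto
  qed simp
  then show ?thesis using tree_aut_length[OF assms, of v] by (auto simp: tree_section_def)
qed

lemma tree_auts_id: "id \<in> tree_auts"
  by (simp add: tree_auts_def)

lemma tree_auts_comp: "g \<in> tree_auts \<Longrightarrow> h \<in> tree_auts \<Longrightarrow> g \<circ> h \<in> tree_auts"
  by (auto simp: tree_auts_def bij_comp)

lemma tree_auts_inv: "g \<in> tree_auts \<Longrightarrow> inv_into UNIV g \<in> tree_auts"
  unfolding tree_auts_def
  by (auto simp: bij_imp_bij_inv bij_is_surj surj_f_inv_f)
     (metis bij_inv_eq_iff surj_f_inv_f bij_is_surj)+

lemma group_AutT: "group AutT"
proof (rule groupI)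
  fix g assume "g \<in> carrier AutT"
  then have "inv_into UNIV g \<in> carrier AutT" "inv_into UNIV g \<circ> g = id"
    by (auto simp: AutT_def tree_auts_inv) (auto simp: tree_auts_def bij_is_inj)
  then show "\<exists>h\<in>carrier AutT. h \<otimes>\<^bsub>AutT\<^esub> g = \<one>\<^bsub>AutT\<^esub>" by (auto simp: AutT_def)
qed (auto simp: AutT_def tree_auts_id tree_auts_comp comp_assoc)

lemma inv_AutT: "g \<in> tree_auts \<Longrightarrow> inv\<^bsub>AutT\<^esub> g = inv_into UNIV g"
  by (rule group.inv_equality[OF group_AutT])
     (auto simp: AutT_def tree_auts_inv, simp add: tree_auts_def bij_is_inj)


section \<open>The second Basilica group\<close>

text \<open>\<open>wr x y\<close> is the automorphism \<open>(x, y)\<close> fixing both letters, \<open>swap_letter\<close> is \<open>\<tau>\<close> viewed as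
  an automorphism with trivial sections.\<close>

fun wr :: "(vertex \<Rightarrow> vertex) \<Rightarrow> (vertex \<Rightarrow> vertex) \<Rightarrow> vertex \<Rightarrow> vertex" where
  "wr x y [] = []"
| "wr x y (False # w) = False # x w"
| "wr x y (True # w) = True # y w"

fun swap_letter :: "vertex \<Rightarrow> vertex" where
  "swap_letter [] = []"
| "swap_letter (l # w) = (\<not> l) # w"

definition gen_a :: "vertex \<Rightarrow> vertex" where
  "gen_a = wr id id \<circ> swap_letter"

definition gen_alpha :: "vertex \<Rightarrow> vertex" where
  "gen_alpha = wr gen_a id"

text \<open>The wreath recursion \<open>c\<^sub>0 = (c\<^sub>1, 1)\<close>, \<open>c\<^sub>1 = (c\<^sub>2, 1)\<close>, \<open>c\<^sub>2 = (c\<^sub>3, 1)\<close>, \<open>c\<^sub>3 = (c\<^sub>0, \<alpha>)\<close>,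
  written out on words so that it terminates; see \<open>gen_c_wr\<close> for the original form.\<close>

fun gen_c0 gen_c1 gen_c2 gen_c3 :: "vertex \<Rightarrow> vertex" where
  "gen_c0 [] = []"
| "gen_c0 (False # w) = False # gen_c1 w"
| "gen_c0 (True # w) = True # w"
| "gen_c1 [] = []"
| "gen_c1 (False # w) = False # gen_c2 w"
| "gen_c1 (True # w) = True # w"
| "gen_c2 [] = []"
| "gen_c2 (False # w) = False # gen_c3 w"
| "gen_c2 (True # w) = True # w"
| "gen_c3 [] = []"
| "gen_c3 (False # w) = False # gen_c0 w"
| "gen_c3 (True # w) = True # gen_alpha w"

lemma word_cases:
  fixes w :: vertex
  obtains "w = []" | u where "w = False # u" | u where "w = True # u"
  by (metis (full_types) neq_Nil_conv)

lemma wr_eqI: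
  assumes "f [] = []" "\<And>w. f (False # w) = False # x w" "\<And>w. f (True # w) = True # y w"
  shows "f = wr x y"
proof
  fix w show "f w = wr x y w"
    using assms by (cases w rule: word_cases) auto
qed

lemma gen_c_wr:
  "gen_c0 = wr gen_c1 id" "gen_c1 = wr gen_c2 id" "gen_c2 = wr gen_c3 id"
  "gen_c3 = wr gen_c0 gen_alpha"
  by (rule wr_eqI; simp)+

lemma wr_section: "tree_section (wr x y) [False] = x" "tree_section (wr x y) [True] = y"
  by (auto simp: tree_section_def)

definition basilica2 :: "(vertex \<Rightarrow> vertex) set" where
  "basilica2 = generate AutT {gen_a, gen_alpha, gen_c0, gen_c1, gen_c2, gen_c3}"


subsection \<open>The generators are tree automorphisms\<close>

lemma tree_autI:
  assumes "bij g" "g [] = []" "\<And>u x. \<exists>y. g (u @ [x]) = g u @ [y]"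
  shows "g \<in> tree_auts"
proof -
  have len: "length (g u) = length u" for u
  proof (induction u rule: rev_induct)
    case (snoc x u)
    then show ?case using assms(3)[of u x] by auto
  qed (simp add: assms)
  have bl: "g (butlast u) = butlast (g u)" for u
  proof (cases u rule: rev_cases)
    case (snoc u' x)
    then show ?thesis using assms(3)[of u' x] by auto
  qed (simp add: assms)
  have snoc_iff: "(\<exists>x. v = u @ [x]) \<longleftrightarrow> v \<noteq> [] \<and> butlast v = u" for u v :: vertex
    by (metis append_butlast_last_id butlast_snoc snoc_eq_iff_butlast)
  have "v \<noteq> [] \<longleftrightarrow> g v \<noteq> []" for v using len[of v] by force
  moreover have "butlast (g v) = g u \<longleftrightarrow> butlast v = u" for u v
    using bl[of v] bij_is_inj[OF assms(1)] by (metis injD)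
  ultimately show ?thesis
    using assms by (auto simp: tree_auts_def tree_adj_def snoc_iff)
qed

lemma tree_autI':
  assumes inj: "\<And>n u v. length u = n \<Longrightarrow> length v = n \<Longrightarrow> g u = g v \<Longrightarrow> u = v"
    and nil: "g [] = []" and ext: "\<And>u x. \<exists>y. g (u @ [x]) = g u @ [y]"
  shows "g \<in> tree_auts"
proof (rule tree_autI[OF _ nil ext])
  have len: "length (g u) = length u" for u
  proof (induction u rule: rev_induct)
    case (snoc x u)
    then show ?case using ext[of u x] by auto
  qed (simp add: nil)
  have "inj g" using inj len by (metis injI)
  moreover have "\<exists>u. g u = v" for v
  proof -
    let ?L = "{u :: vertex. length u = length v}"
    have "finite ?L" using finite_lists_length_eq[of "UNIV :: bool set"] by simp
    moreover have "g ` ?L \<subseteq> ?L" using len by auto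
    moreover have "inj_on g ?L" using \<open>inj g\<close> by (simp add: inj_on_def)
    ultimately have "g ` ?L = ?L" by (simp add: endo_inj_surj)
    then have "v \<in> g ` ?L" by simp
    then show ?thesis by blast
  qed
  ultimately show "bij g" by (metis bijI surjI surj_def)
qed

lemma gen_a_Cons: "gen_a (l # w) = (\<not> l) # w"
  by (cases l) (auto simp: gen_a_def)

lemma gen_a_aut: "gen_a \<in> tree_auts"
proof (rule tree_autI')
  fix n u v assume "length u = n" "length v = n" "gen_a u = gen_a v"
  then show "u = v" by (cases u; cases v) (auto simp: gen_a_Cons)
next
  fix u x show "\<exists>y. gen_a (u @ [x]) = gen_a u @ [y]"
    by (cases u) (auto simp: gen_a_Cons, auto simp: gen_a_def)
qed (simp add: gen_a_def)

lemma wr_inj_level: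
  assumes len: "length u = length v" and eq: "wr x y u = wr x y v"
    and x: "\<And>u' v'. length u' < length u \<Longrightarrow> length u' = length v' \<Longrightarrow> x u' = x v' \<Longrightarrow> u' = v'"
    and y: "\<And>u' v'. length u' < length u \<Longrightarrow> length u' = length v' \<Longrightarrow> y u' = y v' \<Longrightarrow> u' = v'"
  shows "u = v"
proof (cases u rule: word_cases)
  case 1
  then show ?thesis using len by simp
next
  case (2 u')
  then obtain v' where "v = False # v'" "x u' = x v'" "length u' = length v'"
    using len eq by (cases v rule: word_cases) auto
  then show ?thesis using x[of u' v'] 2 by simp
next
  case (3 u')
  then obtain v' where "v = True # v'" "y u' = y v'" "length u' = length v'"
    using len eq by (cases v rule: word_cases) auto
  then show ?thesis using y[of u' v'] 3 by simp
qed

lemma wr_extends: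
  assumes "x [] = []" "y [] = []"
    and "\<And>u' l. length u' < length u \<Longrightarrow> \<exists>k. x (u' @ [l]) = x u' @ [k]"
    and "\<And>u' l. length u' < length u \<Longrightarrow> \<exists>k. y (u' @ [l]) = y u' @ [k]"
  shows "\<exists>k. wr x y (u @ [l]) = wr x y u @ [k]"
  using assms by (cases l; cases u rule: word_cases) auto

lemma gen_alpha_aut: "gen_alpha \<in> tree_auts"
proof (rule tree_autI')
  fix n u v assume "length u = n" "length v = n" "gen_alpha u = gen_alpha v"
  moreover have "inj gen_a" using gen_a_aut by (simp add: tree_auts_def bij_is_inj)
  ultimately show "u = v"
    unfolding gen_alpha_def by (intro wr_inj_level[of u v gen_a id]) (auto dest: injD)
next
  fix u x show "\<exists>y. gen_alpha (u @ [x]) = gen_alpha u @ [y]"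
    unfolding gen_alpha_def
    by (rule wr_extends) (auto simp: tree_aut_extends[OF gen_a_aut], simp add: gen_a_def)
qed (simp add: gen_alpha_def)

lemma gen_c_inj:
  "gen_c0 u = gen_c0 v \<Longrightarrow> u = v" "gen_c1 u = gen_c1 v \<Longrightarrow> u = v"
  "gen_c2 u = gen_c2 v \<Longrightarrow> u = v" "gen_c3 u = gen_c3 v \<Longrightarrow> u = v"
proof (induction u and u and u and u arbitrary: v and v and v and v
    rule: gen_c0_gen_c1_gen_c2_gen_c3.induct)
  case (12 w)
  then obtain w' where "v = True # w'" "gen_alpha w = gen_alpha w'"
    by (cases v rule: word_cases) auto
  then show ?case using gen_alpha_aut by (auto simp: tree_auts_def dest: bij_is_inj injD)
qed (rule_tac w = v in word_cases; simp; fail)+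

lemma gen_c_ext:
  "\<exists>k. gen_c0 (u @ [l]) = gen_c0 u @ [k]" "\<exists>k. gen_c1 (u @ [l]) = gen_c1 u @ [k]"
  "\<exists>k. gen_c2 (u @ [l]) = gen_c2 u @ [k]" "\<exists>k. gen_c3 (u @ [l]) = gen_c3 u @ [k]"
proof (induction u and u and u and u rule: gen_c0_gen_c1_gen_c2_gen_c3.induct)
  case (12 w)
  then show ?case using tree_aut_extends[OF gen_alpha_aut] by auto
qed (cases l; auto simp: gen_alpha_def)+

lemma gen_c_aut:
  "gen_c0 \<in> tree_auts" "gen_c1 \<in> tree_auts" "gen_c2 \<in> tree_auts" "gen_c3 \<in> tree_auts"
  by (rule tree_autI', erule gen_c_inj, simp, rule gen_c_ext)+

lemma subgroup_basilica2: "subgroup basilica2 AutT"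
  unfolding basilica2_def
  by (rule group.generate_is_subgroup[OF group_AutT])
     (use gen_a_aut gen_alpha_aut gen_c_aut in \<open>auto simp: AutT_def\<close>)


section \<open>Saturated groups\<close>

definition level_stabilizer :: "(vertex \<Rightarrow> vertex) set \<Rightarrow> nat \<Rightarrow> (vertex \<Rightarrow> vertex) set" where
  "level_stabilizer G n = {g \<in> G. \<forall>v. length v = n \<longrightarrow> g v = v}"

definition characteristic :: "'a set \<Rightarrow> 'a monoid \<Rightarrow> bool" where
  "characteristic H G \<longleftrightarrow> subgroup H G \<and> (\<forall>\<phi> \<in> carrier (AutoGroup G). \<phi> ` H = H)"

definition acts_transitively_on :: "('b \<Rightarrow> 'b) set \<Rightarrow> 'b set \<Rightarrow> bool" where
  "acts_transitively_on H S \<longleftrightarrow>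
     (\<forall>h\<in>H. h ` S = S) \<and> (\<forall>x\<in>S. \<forall>y\<in>S. \<exists>h\<in>H. h x = y)"

definition saturated :: "(vertex \<Rightarrow> vertex) set \<Rightarrow> bool" where
  "saturated G \<longleftrightarrow> subgroup G AutT \<and>
     (\<forall>n. \<exists>H. H \<subseteq> level_stabilizer G n \<and> characteristic H (as_group G) \<and>
        (\<forall>v m. length v = n \<longrightarrow> acts_transitively_on H {v @ w | w. length w = m}))"


section \<open>Conjugation by the normaliser\<close>

text \<open>The map \<open>g \<mapsto> (x \<mapsto> g x g\<inverse>)\<close>. The automorphisms of \<open>G\<close> that form the library's
  \<^const>\<open>AutoGroup\<close> are extensional functions on \<open>G\<close>, hence the restriction.\<close>

definition conj_map :: "(vertex \<Rightarrow> vertex) set \<Rightarrow> (vertex \<Rightarrow> vertex) \<Rightarrow> (vertex \<Rightarrow> vertex) \<Rightarrow> (vertex \<Rightarrow> vertex)"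
  where "conj_map G g = (\<lambda>x\<in>G. g \<otimes>\<^bsub>AutT\<^esub> x \<otimes>\<^bsub>AutT\<^esub> inv\<^bsub>AutT\<^esub> g)"

end

theory Submission
  imports Defs "HOL-Library.Sublist"
begin

text \<open>Write \<open>B\<close> for the group \<^const>\<open>basilica2\<close>.

  Saturation rests on powers. If \<open>g\<close> fixes a level pointwise, then \<open>g\<^sup>2\<close> fixes the next one, so
  the subgroup generated by all powers \<open>x ^^ 2 ^ n\<close> lies in the stabiliser of level \<open>n\<close>, and it is
  characteristic because automorphisms respect powers. It is spherically transitive on the subtrees
  at level \<open>n\<close> as soon as the group contains one odometer, an element permuting each level in a
  single cycle: its \<open>2 ^ n\<close>-th power runs through every level of each of these subtrees
  (\<open>odometer_saturated\<close>). In \<open>B\<close> the products \<open>c \<alpha> a\<close> and \<open>c a \<alpha>\<close> are odometers, where \<open>c\<close> is a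
  cyclic rotation of \<open>c\<^sub>0 c\<^sub>1 c\<^sub>2 c\<^sub>3\<close>. Indeed \<open>c = (c', \<alpha>)\<close> with another rotation \<open>c'\<close>, so the square of
  one of these products swaps no letter and acts below the letter 0 as another of them
  (\<open>basilica2_odometer\<close>).

  The second half is an instance of the rigidity theorem of Lavreniuk and Nekrashevych: a saturated
  group \<open>G\<close> all of whose rigid vertex stabilisers are nontrivial has only the automorphisms induced
  by its normaliser (\<open>saturated_conj_map_iso\<close>). Let \<open>H n\<close> be a decreasing chain of characteristic
  subgroups as in the definition of saturation, and for a vertex \<open>v\<close> of level \<open>n\<close> let \<open>A v\<close> be the
  group of those elements of \<open>H n\<close> that move only vertices below \<open>v\<close>. For distinct \<open>v\<close> of the same
  level these groups commute, and \<open>H n\<close> normalises them. An automorphism \<open>\<phi>\<close> preserves \<open>H n\<close>, so the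
  groups \<open>\<phi> (A v)\<close> again commute and are normalised by \<open>H n\<close>. Two commuting subgroups normalised by
  \<open>H n\<close> cannot both act nontrivially below the same vertex of level \<open>n\<close>: by transitivity of \<open>H n\<close>
  both would contain commutators agreeing, below some deeper vertex \<open>z\<close>, with arbitrary elements of
  the nonabelian group \<open>A z\<close> (\<open>commuting_normal_subgroups_disjoint\<close>). There are as many groups
  \<open>\<phi> (A v)\<close> as vertices \<open>w\<close> of level \<open>n\<close>, so each of them acts nontrivially below exactly one \<open>w\<close>. The
  map \<open>v \<mapsto> w\<close> is a tree automorphism, and conjugation by it is \<open>\<phi>\<close> (\<open>Auto_is_conj\<close>).

  That \<open>B\<close> has nontrivial rigid stabilisers follows from fourth powers. Each \<open>g \<in> B\<close> is the first
  coordinate of some \<open>(g, y) \<in> B\<close> with \<open>y\<close> in the group generated by \<open>\<alpha>\<close> and \<open>c\<^sub>0\<close>, which has exponent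
  4. Hence \<open>(g, y)\<^sup>4 = (g\<^sup>4, 1)\<close> is again a fourth power of an element of \<open>B\<close>, and iterating this pushes
  a nontrivial fourth power down the leftmost path (\<open>basilica2_rigid_stabilizer_spine\<close>).\<close>

section \<open>Tree automorphisms, conjugation and supports\<close>

lemma tree_aut_inv_left: "g \<in> tree_auts \<Longrightarrow> inv_into UNIV g (g u) = u"
  by (simp add: tree_auts_def bij_is_inj)

lemma tree_aut_inv_right: "g \<in> tree_auts \<Longrightarrow> g (inv_into UNIV g u) = u"
  by (simp add: tree_auts_def bij_is_surj surj_f_inv_f)

lemma tree_aut_eq_iff: "g \<in> tree_auts \<Longrightarrow> g u = g v \<longleftrightarrow> u = v"
  by (metis tree_aut_inv_left)

lemma tree_aut_prefix_iff:
  assumes "g \<in> tree_auts"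
  shows "prefix (g v) (g u) \<longleftrightarrow> prefix v u"
proof -
  have imp: "prefix (h v) (h u)" if "h \<in> tree_auts" "prefix v u" for h u v
    using that tree_section_eq by (auto simp: prefix_def)
  show ?thesis
    using imp[of g v u] imp[of "inv_into UNIV g" "g v" "g u"] assms
    by (auto simp: tree_aut_inv_left tree_auts_inv)
qed

text \<open>Padding a moved vertex by further letters keeps it moved. This is how two elements moving
  vertices at different depths are made to move vertices of a common length.\<close>

lemma tree_aut_moves_extension:
  assumes "g \<in> tree_auts" "g u \<noteq> u"
  shows "g (u @ w) \<noteq> u @ w"
  using assms tree_section_eq[of g u w] tree_aut_length[of g u] by auto

lemma AutT_simps: "carrier AutT = tree_auts" "mult AutT = (\<circ>)" "one AutT = id"
  by (simp_all add: AutT_def)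

definition tree_conj :: "(vertex \<Rightarrow> vertex) \<Rightarrow> (vertex \<Rightarrow> vertex) \<Rightarrow> vertex \<Rightarrow> vertex" where
  "tree_conj g x = g \<circ> x \<circ> inv_into UNIV g"

lemma tree_conj_apply: "g \<in> tree_auts \<Longrightarrow> tree_conj g x (g u) = g (x u)"
  by (simp add: tree_conj_def tree_aut_inv_left)

lemma tree_conj_eq_iff:
  assumes "g \<in> tree_auts"
  shows "tree_conj g x = y \<longleftrightarrow> g \<circ> x = y \<circ> g"
proof
  assume "g \<circ> x = y \<circ> g"
  then have "g (x (inv_into UNIV g u)) = y u" for u
    using assms by (metis comp_apply tree_aut_inv_right)
  then show "tree_conj g x = y" by (simp add: tree_conj_def fun_eq_iff)
next
  assume "tree_conj g x = y"
  then show "g \<circ> x = y \<circ> g" using tree_conj_apply[OF assms, of x] by auto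
qed

lemma tree_conj_comp:
  "g \<in> tree_auts \<Longrightarrow> tree_conj g (x \<circ> y) = tree_conj g x \<circ> tree_conj g y"
  by (simp add: tree_conj_def fun_eq_iff tree_aut_inv_left)

lemma tree_conj_conj:
  assumes "g \<in> tree_auts" "h \<in> tree_auts"
  shows "tree_conj g (tree_conj h x) = tree_conj (g \<circ> h) x"
proof -
  have "g \<circ> h \<in> tree_auts" using assms by (rule tree_auts_comp)
  moreover have "g \<circ> h \<circ> x = tree_conj g (tree_conj h x) \<circ> (g \<circ> h)"
    using assms by (simp add: fun_eq_iff tree_conj_apply)
  ultimately show ?thesis by (metis tree_conj_eq_iff)
qed

lemma tree_conj_inv_cancel:
  assumes "g \<in> tree_auts"
  shows "tree_conj g (tree_conj (inv_into UNIV g) x) = x"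
  using assms by (simp add: tree_conj_def fun_eq_iff tree_auts_inv tree_aut_inv_left tree_aut_inv_right)

lemma tree_conj_inj:
  assumes "g \<in> tree_auts"
  shows "tree_conj g x = tree_conj g y \<longleftrightarrow> x = y"
proof
  assume "tree_conj g x = tree_conj g y"
  then have "g (x u) = g (y u)" for u using assms by (metis tree_conj_apply)
  then show "x = y" using assms by (simp add: tree_aut_eq_iff fun_eq_iff)
qed simp

definition supported_below :: "vertex \<Rightarrow> (vertex \<Rightarrow> vertex) \<Rightarrow> bool" where
  "supported_below v r \<longleftrightarrow> (\<forall>u. \<not> prefix v u \<longrightarrow> r u = u)"

lemma supported_below_mono: "supported_below w r \<Longrightarrow> prefix v w \<Longrightarrow> supported_below v r"
  by (meson supported_below_def prefix_order.trans)

lemma supported_below_comp: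
  "supported_below v r \<Longrightarrow> supported_below v s \<Longrightarrow> supported_below v (r \<circ> s)"
  by (simp add: supported_below_def)

lemma supported_below_inv:
  "r \<in> tree_auts \<Longrightarrow> supported_below v r \<Longrightarrow> supported_below v (inv_into UNIV r)"
  by (metis supported_below_def tree_aut_inv_left)

lemma supported_below_conj:
  assumes "g \<in> tree_auts" "supported_below v r"
  shows "supported_below (g v) (tree_conj g r)"
  unfolding supported_below_def
proof (intro allI impI)
  fix u assume "\<not> prefix (g v) u"
  then have "\<not> prefix v (inv_into UNIV g u)"
    using assms(1) by (metis tree_aut_prefix_iff tree_aut_inv_right)
  then show "tree_conj g r u = u"
    using assms by (simp add: supported_below_def tree_conj_def tree_aut_inv_right)
qed

lemma prefix_same_length_eq: "prefix v u \<Longrightarrow> prefix w u \<Longrightarrow> length v = length w \<Longrightarrow> v = w"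
  by (auto simp: prefix_def)

text \<open>Used mainly for \<open>r\<close> and a conjugate of \<open>r\<close>: if the conjugation moves the vertex \<open>v\<close>, the two are
  equal only if \<open>r\<close> is the identity.\<close>

lemma supported_below_both_id:
  assumes "supported_below v r" "supported_below w r" "length v = length w" "v \<noteq> w"
  shows "r = id"
proof
  fix u show "r u = id u"
    using assms prefix_same_length_eq[of v u w] by (auto simp: supported_below_def)
qed

lemma supported_below_prefix:
  assumes "r \<in> tree_auts" "supported_below v r" "prefix v u"
  shows "prefix v (r u)"
  using assms by (metis supported_below_def tree_aut_eq_iff)

lemma supported_below_commute:
  assumes "r \<in> tree_auts" "s \<in> tree_auts" "supported_below v r" "supported_below w s"
    and "length v = length w" "v \<noteq> w"
  shows "r \<circ> s = s \<circ> r"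
proof
  fix u
  consider "prefix v u" "\<not> prefix w u" | "prefix w u" "\<not> prefix v u" 
    | "\<not> prefix v u" "\<not> prefix w u"
    using prefix_same_length_eq assms(5,6) by blast
  then show "(r \<circ> s) u = (s \<circ> r) u"
  proof cases
    case 1
    then have "\<not> prefix w (r u)"
      using supported_below_prefix[OF assms(1,3)] prefix_same_length_eq assms(5,6) by blast
    then show ?thesis using 1 assms(4) by (simp add: supported_below_def)
  next
    case 2
    then have "\<not> prefix v (s u)"
      using supported_below_prefix[OF assms(2,4)] prefix_same_length_eq assms(5,6) by blast
    then show ?thesis using 2 assms(3) by (simp add: supported_below_def)
  next
    case 3
    then show ?thesis using assms(3,4) by (simp add: supported_below_def)
  qed
qed

section \<open>Subgroups of the automorphism group of the tree and their automorphisms\<close>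

locale tree_group =
  fixes G :: "(vertex \<Rightarrow> vertex) set"
  assumes sub: "subgroup G AutT"
begin

lemma auts: "x \<in> G \<Longrightarrow> x \<in> tree_auts"
  using subgroup.subset[OF sub] by (auto simp: AutT_def)

lemma id_mem: "id \<in> G"
  using subgroup.one_closed[OF sub] by (simp add: AutT_def)

lemma comp_mem: "x \<in> G \<Longrightarrow> y \<in> G \<Longrightarrow> x \<circ> y \<in> G"
  using subgroup.m_closed[OF sub] by (simp add: AutT_def)

lemma inv_mem: "x \<in> G \<Longrightarrow> inv_into UNIV x \<in> G"
  using subgroup.m_inv_closed[OF sub] by (metis auts inv_AutT)

lemma conj_mem: "x \<in> G \<Longrightarrow> y \<in> G \<Longrightarrow> tree_conj x y \<in> G"
  by (simp add: tree_conj_def comp_mem inv_mem)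

lemma group_as_group: "group (as_group G)"
  using group.subgroup_imp_group[OF group_AutT sub] .

lemma inv_as_group: "x \<in> G \<Longrightarrow> inv\<^bsub>as_group G\<^esub> x = inv_into UNIV x"
  using group.m_inv_consistent[OF group_AutT sub] by (metis auts inv_AutT)

lemma as_group_subgroupI:
  assumes "H \<subseteq> G" "id \<in> H" "\<And>x y. x \<in> H \<Longrightarrow> y \<in> H \<Longrightarrow> x \<circ> y \<in> H"
    "\<And>x. x \<in> H \<Longrightarrow> inv_into UNIV x \<in> H"
  shows "subgroup H (as_group G)"
  by (rule group.subgroupI[OF group_as_group]) (use assms inv_as_group in \<open>auto simp: AutT_def\<close>)

lemma subgroup_tree_group: "subgroup H (as_group G) \<Longrightarrow> tree_group H"
  using group.incl_subgroup[OF group_AutT sub] by (simp add: tree_group_def)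

lemma Auto_iff:
  "\<phi> \<in> carrier (AutoGroup (as_group G)) \<longleftrightarrow>
     \<phi> \<in> extensional G \<and> bij_betw \<phi> G G \<and> (\<forall>x\<in>G. \<forall>y\<in>G. \<phi> (x \<circ> y) = \<phi> x \<circ> \<phi> y)"
  by (auto simp: AutoGroup_def auto_def hom_def Bij_def AutT_def bij_betw_def)

lemma Auto_mem: "\<phi> \<in> carrier (AutoGroup (as_group G)) \<Longrightarrow> x \<in> G \<Longrightarrow> \<phi> x \<in> G"
  by (auto simp: Auto_iff bij_betw_def)

lemma Auto_comp:
  "\<phi> \<in> carrier (AutoGroup (as_group G)) \<Longrightarrow> x \<in> G \<Longrightarrow> y \<in> G \<Longrightarrow> \<phi> (x \<circ> y) = \<phi> x \<circ> \<phi> y"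
  by (simp add: Auto_iff)

lemma Auto_id:
  assumes "\<phi> \<in> carrier (AutoGroup (as_group G))"
  shows "\<phi> id = id"
proof -
  have "\<phi> id \<circ> \<phi> id = \<phi> id" using Auto_comp[OF assms id_mem id_mem] by simp
  then have "\<phi> id u = u" for u
    using tree_aut_eq_iff[OF auts[OF Auto_mem[OF assms id_mem]]] by (metis comp_apply)
  then show ?thesis by auto
qed

lemma Auto_inv:
  assumes "\<phi> \<in> carrier (AutoGroup (as_group G))" "x \<in> G"
  shows "\<phi> (inv_into UNIV x) = inv_into UNIV (\<phi> x)"
proof -
  have "x \<circ> inv_into UNIV x = id" using tree_aut_inv_right[OF auts[OF assms(2)]] by auto
  then have "\<phi> x \<circ> \<phi> (inv_into UNIV x) = id"
    using Auto_comp[OF assms(1,2) inv_mem[OF assms(2)]] Auto_id[OF assms(1)] by metis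
  then have "\<phi> x (\<phi> (inv_into UNIV x) u) = u" for u by (metis comp_apply id_apply)
  then have "\<phi> (inv_into UNIV x) u = inv_into UNIV (\<phi> x) u" for u
    using tree_aut_inv_left[OF auts[OF Auto_mem[OF assms]]] by metis
  then show ?thesis by auto
qed

lemma funpow_mem: "x \<in> G \<Longrightarrow> x ^^ k \<in> G"
  by (induction k) (auto simp: id_mem comp_mem simp flip: id_def)

lemma Auto_funpow:
  "\<phi> \<in> carrier (AutoGroup (as_group G)) \<Longrightarrow> x \<in> G \<Longrightarrow> \<phi> (x ^^ k) = \<phi> x ^^ k"
  by (induction k) (auto simp: Auto_id Auto_comp funpow_mem simp flip: id_def)

lemma Auto_mult:
  assumes "\<phi> \<in> carrier (AutoGroup (as_group G))" "\<psi> \<in> carrier (AutoGroup (as_group G))"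
  shows "\<phi> \<otimes>\<^bsub>AutoGroup (as_group G)\<^esub> \<psi> = compose G \<phi> \<psi>"
  using assms by (auto simp: AutoGroup_def auto_def BijGroup_def)

lemma normalizer_iff:
  "g \<in> normalizer AutT G \<longleftrightarrow> g \<in> tree_auts \<and> tree_conj g ` G = G"
proof -
  have "g <#\<^bsub>AutT\<^esub> G #>\<^bsub>AutT\<^esub> inv\<^bsub>AutT\<^esub> g = tree_conj g ` G" if "g \<in> tree_auts"
    using that by (auto simp: l_coset_def r_coset_def inv_AutT tree_conj_def AutT_simps)
  moreover have "G \<subseteq> carrier AutT" using subgroup.subset[OF sub] .
  ultimately show ?thesis
    by (auto simp: normalizer_def stabilizer_def AutT_simps)
qed

lemma conj_image: assumes "g \<in> G" shows "tree_conj g ` G = G"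
proof
  show "tree_conj g ` G \<subseteq> G" using assms conj_mem by blast
  show "G \<subseteq> tree_conj g ` G"
  proof
    fix x assume "x \<in> G"
    then have "tree_conj (inv_into UNIV g) x \<in> G" using assms conj_mem inv_mem by blast
    then show "x \<in> tree_conj g ` G"
      using tree_conj_inv_cancel[OF auts[OF assms], of x] by (metis imageI)
  qed
qed

lemma conj_map_eq: "g \<in> tree_auts \<Longrightarrow> conj_map G g = (\<lambda>x\<in>G. tree_conj g x)"
  by (auto simp: conj_map_def inv_AutT tree_conj_def AutT_simps)

lemma conj_map_Auto:
  assumes "g \<in> normalizer AutT G"
  shows "conj_map G g \<in> carrier (AutoGroup (as_group G))"
proof -
  have g: "g \<in> tree_auts" "tree_conj g ` G = G" using assms normalizer_iff by auto
  then have "bij_betw (tree_conj g) G G" by (simp add: bij_betw_def inj_on_def tree_conj_inj)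
  then show ?thesis
    using g by (auto simp: Auto_iff conj_map_eq comp_mem tree_conj_comp cong: bij_betw_cong)
qed

text \<open>Inner automorphisms are automorphisms, so characteristic subgroups are normal.\<close>

lemma characteristic_conj:
  assumes "characteristic H (as_group G)" "g \<in> G" "x \<in> H"
  shows "tree_conj g x \<in> H"
proof -
  have "g \<in> normalizer AutT G" using assms(2) conj_image auts normalizer_iff by blast
  then have "conj_map G g ` H = H"
    using assms(1) conj_map_Auto by (simp add: characteristic_def)
  moreover have "x \<in> G" 
    using assms(1,3) subgroup.subset by (fastforce simp: characteristic_def)
  ultimately have "conj_map G g x \<in> H" "conj_map G g x = tree_conj g x"
    using assms by (auto simp: conj_map_eq auts)
  then show ?thesis by simp
qed

lemma characteristic_generate:
  assumes "S \<subseteq> G" "\<And>\<phi>. \<phi> \<in> carrier (AutoGroup (as_group G)) \<Longrightarrow> \<phi> ` S = S"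
  shows "characteristic (generate (as_group G) S) (as_group G)"
  unfolding characteristic_def
proof (intro conjI ballI)
  show "subgroup (generate (as_group G) S) (as_group G)"
    using group.generate_is_subgroup[OF group_as_group] assms(1) by simp
  fix \<phi> assume \<phi>: "\<phi> \<in> carrier (AutoGroup (as_group G))"
  then interpret group_hom "as_group G" "as_group G" \<phi>
    using group_as_group
    by (auto simp: group_hom_def group_hom_axioms_def AutoGroup_def auto_def)
  show "\<phi> ` generate (as_group G) S = generate (as_group G) S"
    using generate_img[of S] assms \<phi> by simp
qed

lemma subgroup_level_stabilizer: "subgroup (level_stabilizer G n) (as_group G)"
proof (rule as_group_subgroupI)
  fix x assume x: "x \<in> level_stabilizer G n"
  then have "inv_into UNIV x u = u" if "length u = n" for u
    using that tree_aut_inv_left[OF auts, of x u] by (simp add: level_stabilizer_def)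
  then show "inv_into UNIV x \<in> level_stabilizer G n"
    using x by (simp add: level_stabilizer_def inv_mem)
qed (auto simp: level_stabilizer_def id_mem comp_mem)

end

section \<open>Rigidity of saturated weakly branch groups\<close>

definition rigid_stabilizer :: "(vertex \<Rightarrow> vertex) set \<Rightarrow> vertex \<Rightarrow> (vertex \<Rightarrow> vertex) set" where
  "rigid_stabilizer G v = {g \<in> G. supported_below v g}"

definition moves_below :: "(vertex \<Rightarrow> vertex) set \<Rightarrow> vertex \<Rightarrow> bool" where
  "moves_below Q w \<longleftrightarrow> (\<exists>q\<in>Q. \<exists>u. q (w @ u) \<noteq> w @ u)"

text \<open>A tree automorphism \<open>t\<close> centralising \<open>G\<close> cannot move a vertex \<open>v\<close>, because it would conjugate
  \<open>rigid_stabilizer G v\<close> to a group acting below \<open>t v\<close>, while fixing each of its elements. This gives the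
  injectivity of \<^const>\<open>conj_map\<close>.\<close>

lemma (in tree_group) trivial_centralizer:
  assumes rist: "\<And>v. \<exists>r\<in>rigid_stabilizer G v. r \<noteq> id"
    and t: "t \<in> tree_auts" "\<And>x. x \<in> G \<Longrightarrow> tree_conj t x = x"
  shows "t = id"
proof (rule ccontr)
  assume "t \<noteq> id"
  then obtain v where v: "t v \<noteq> v" by (auto simp: fun_eq_iff)
  obtain r where r: "r \<in> G" "supported_below v r" "r \<noteq> id"
    using rist[of v] by (auto simp: rigid_stabilizer_def)
  have "supported_below (t v) r"
    using supported_below_conj[OF t(1) r(2)] t(2)[OF r(1)] by simp
  then show False
    using supported_below_both_id[OF r(2)] v r(3) tree_aut_length[OF t(1)] by metis
qed

text \<open>A saturated group with nontrivial rigid stabilisers, together with subgroups \<open>H n\<close> witnessing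
  saturation. The witnesses can be chosen decreasing (see \<open>saturated_chain_exists\<close>), which makes
  the groups \<open>deep_rist v\<close> below decrease along paths of the tree; this is why the vertex map built
  from an automorphism preserves adjacency.\<close>

locale saturated_chain = tree_group +
  fixes H :: "nat \<Rightarrow> (vertex \<Rightarrow> vertex) set"
  assumes H_stab: "H n \<subseteq> level_stabilizer G n"
    and H_char: "characteristic (H n) (as_group G)"
    and H_antimono: "m \<le> n \<Longrightarrow> H n \<subseteq> H m"
    and H_trans: "length w = length w' \<Longrightarrow> \<exists>h\<in>H (length v). h (v @ w) = v @ w'"
    and rist_nontrivial: "\<exists>r\<in>rigid_stabilizer G v. r \<noteq> id"
begin

lemma H_group: "tree_group (H n)"
  using H_char subgroup_tree_group by (simp add: characteristic_def)

lemma H_mem: "h \<in> H n \<Longrightarrow> h \<in> G"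
  using H_stab by (auto simp: level_stabilizer_def)

lemma H_fixes: "h \<in> H n \<Longrightarrow> length v = n \<Longrightarrow> h v = v"
  using H_stab by (auto simp: level_stabilizer_def)

lemma H_conj: "g \<in> G \<Longrightarrow> h \<in> H n \<Longrightarrow> tree_conj g h \<in> H n"
  using characteristic_conj[OF H_char] .

text \<open>Unlike the rigid stabiliser itself, its part in the characteristic subgroup of the same level
  is mapped by every automorphism of \<open>G\<close> into that level stabiliser.\<close>

definition deep_rist :: "vertex \<Rightarrow> (vertex \<Rightarrow> vertex) set" where
  "deep_rist v = rigid_stabilizer G v \<inter> H (length v)"

lemma deep_rist_iff: "r \<in> deep_rist v \<longleftrightarrow> r \<in> H (length v) \<and> supported_below v r"
  using H_mem by (auto simp: deep_rist_def rigid_stabilizer_def)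

lemma deep_rist_mem: "r \<in> deep_rist v \<Longrightarrow> r \<in> G"
  by (simp add: deep_rist_def rigid_stabilizer_def)

lemma deep_rist_mono: "prefix v w \<Longrightarrow> deep_rist w \<subseteq> deep_rist v"
  using H_antimono[OF prefix_length_le, of v w] supported_below_mono[of w _ v]
  by (auto simp: deep_rist_iff)

lemma deep_rist_conj:
  assumes "g \<in> G" "r \<in> deep_rist v" shows "tree_conj g r \<in> deep_rist (g v)"
  using assms H_conj supported_below_conj auts tree_aut_length by (simp add: deep_rist_iff)

lemma deep_rist_group: "tree_group (deep_rist v)"
proof -
  interpret K: tree_group "H (length v)" by (rule H_group)
  have "subgroup (deep_rist v) (as_group G)"
    by (rule as_group_subgroupI)
       (auto simp: deep_rist_iff H_mem K.id_mem K.comp_mem K.inv_mem K.auts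
          supported_below_comp supported_below_inv, simp add: supported_below_def)
  then show ?thesis by (rule subgroup_tree_group)
qed

text \<open>Take \<open>r\<close> in the rigid stabiliser of the left child of \<open>v\<close> and \<open>h \<in> H (length v)\<close> mapping the left
  child to the right child. The commutator of \<open>h\<close> and \<open>r\<close> lies in the normal subgroup
  \<open>H (length v)\<close>, and it is nontrivial because it acts below the left child as the inverse of \<open>r\<close>.\<close>

lemma deep_rist_nontrivial: "\<exists>r\<in>deep_rist v. r \<noteq> id"
proof -
  interpret K: tree_group "H (length v)" by (rule H_group)
  obtain h where h: "h \<in> H (length v)" "h (v @ [False]) = v @ [True]"
    using H_trans[of "[False]" "[True]" v] by auto
  obtain r where r: "r \<in> G" "supported_below (v @ [False]) r" "r \<noteq> id"
    using rist_nontrivial[of "v @ [False]"] by (auto simp: rigid_stabilizer_def)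
  let ?r' = "tree_conj h r"
  have r': "supported_below (v @ [True]) ?r'"
    using supported_below_conj[OF K.auts[OF h(1)] r(2)] h(2) by simp
  have nid: "?r' \<noteq> r"
    using supported_below_both_id[OF r(2), of "v @ [True]"] r' r(3) by auto
  let ?k = "?r' \<circ> inv_into UNIV r"
  have "?k = h \<circ> tree_conj r (inv_into UNIV h)" by (simp add: tree_conj_def comp_assoc)
  then have "?k \<in> H (length v)" using h(1) r(1) by (simp add: K.comp_mem K.inv_mem H_conj)
  moreover have "supported_below v ?k"
    using r r' auts by (intro supported_below_comp supported_below_inv)
       (auto intro: supported_below_mono)
  moreover have "?k \<noteq> id"
  proof
    assume "?k = id"
    then have "?r' u = r u" for u
      using tree_aut_inv_left[OF auts[OF r(1)], of u] by (metis comp_apply id_apply)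
    then show False using nid by auto
  qed
  ultimately show ?thesis by (auto simp: deep_rist_iff)
qed

text \<open>If \<open>r\<close> in the group moves \<open>u\<close>, it does not commute with the nontrivial elements that act only
  below \<open>u\<close>.\<close>

lemma deep_rist_nonabelian: "\<exists>r\<in>deep_rist v. \<exists>s\<in>deep_rist v. r \<circ> s \<noteq> s \<circ> r"
proof -
  obtain r where r: "r \<in> deep_rist v" "r \<noteq> id" using deep_rist_nontrivial by blast
  then obtain u where u: "r u \<noteq> u" by (auto simp: fun_eq_iff)
  then have "prefix v u" using r(1) by (auto simp: deep_rist_iff supported_below_def)
  obtain s where s: "s \<in> deep_rist u" "s \<noteq> id" using deep_rist_nontrivial by blast
  have rG: "r \<in> tree_auts" using r(1) deep_rist_mem auts by blast
  have "tree_conj r s \<noteq> s"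
    using supported_below_both_id[of u s "r u"] supported_below_conj[OF rG, of u s] s u
      tree_aut_length[OF rG, of u] by (auto simp: deep_rist_iff)
  then have "r \<circ> s \<noteq> s \<circ> r" using tree_conj_eq_iff[OF rG] by blast
  moreover have "s \<in> deep_rist v" using s(1) deep_rist_mono[OF \<open>prefix v u\<close>] by blast
  ultimately show ?thesis using r(1) by blast
qed

text \<open>The heart of the rigidity argument. Normality under \<open>H (length w)\<close>, which is transitive below
  \<open>w\<close>, allows one to pick \<open>p \<in> P\<close> and \<open>q \<in> Q\<close> moving the same vertex \<open>z\<close> below \<open>w\<close>. For \<open>r \<in> deep_rist z\<close>
  the commutator \<open>p r\<inverse> p\<inverse> r\<close> lies in \<open>P\<close>; since \<open>p r\<inverse> p\<inverse>\<close> acts only below \<open>p z \<noteq> z\<close>, the commutator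
  agrees with \<open>r\<close> below \<open>z\<close>. The same works in \<open>Q\<close> for \<open>s \<in> deep_rist z\<close>, so \<open>r\<close> and \<open>s\<close> commute, which
  contradicts \<open>deep_rist_nonabelian\<close>.\<close>

lemma commuting_normal_subgroups_disjoint:
  assumes P: "tree_group P" "\<And>h x. h \<in> H (length w) \<Longrightarrow> x \<in> P \<Longrightarrow> tree_conj h x \<in> P"
    and Q: "tree_group Q" "\<And>h x. h \<in> H (length w) \<Longrightarrow> x \<in> Q \<Longrightarrow> tree_conj h x \<in> Q"
    and comm: "\<And>x y. x \<in> P \<Longrightarrow> y \<in> Q \<Longrightarrow> x \<circ> y = y \<circ> x"
    and "moves_below P w" "moves_below Q w"
  shows False
proof -
  interpret K: tree_group "H (length w)" by (rule H_group)
  interpret P: tree_group P by fact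
  interpret Q: tree_group Q by fact
  obtain p u where p: "p \<in> P" "p (w @ u) \<noteq> w @ u" using assms by (auto simp: moves_below_def)
  obtain q0 u' where q0: "q0 \<in> Q" "q0 (w @ u') \<noteq> w @ u'"
    using assms by (auto simp: moves_below_def)
  define z where "z = w @ u @ u'"
  have pz: "p z \<noteq> z" using tree_aut_moves_extension[of p "w @ u" u'] P.auts p by (simp add: z_def)
  obtain h where h: "h \<in> H (length w)" "h (w @ u' @ u) = z"
    using H_trans[of "u' @ u" "u @ u'" w] by (auto simp: z_def)
  define q where "q = tree_conj h q0"
  have q: "q \<in> Q" using Q(2) h(1) q0(1) by (simp add: q_def)
  have "q0 (w @ u' @ u) \<noteq> w @ u' @ u"
    using tree_aut_moves_extension[of q0 "w @ u'" u] Q.auts q0 by simp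
  then have qz: "q z \<noteq> z"
    using h tree_conj_apply[of h q0 "w @ u' @ u"] tree_aut_eq_iff[of h] K.auts
    by (metis q_def)
  have sub: "r \<in> H (length w)" if "r \<in> deep_rist z" for r
    using that H_antimono[of "length w" "length z"] by (auto simp: deep_rist_iff z_def)
  have commutator: "\<exists>k\<in>S. \<forall>y. prefix z y \<longrightarrow> k y = r y"
    if S: "tree_group S" "\<And>h x. h \<in> H (length w) \<Longrightarrow> x \<in> S \<Longrightarrow> tree_conj h x \<in> S"
      and x: "x \<in> S" "x z \<noteq> z" and r: "r \<in> deep_rist z" for S x r
  proof -
    interpret S: tree_group S by fact
    let ?ri = "inv_into UNIV r"
    have ri: "?ri \<in> H (length w)" using sub r by (simp add: K.inv_mem)
    have r_aut: "r \<in> tree_auts" using sub r K.auts by simp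
    \<comment> \<open>This is \<open>x r\<inverse> x\<inverse> r\<close>, bracketed as \<open>x\<close> times a conjugate of \<open>x\<inverse>\<close> by an element of \<open>H\<close>.\<close>
    let ?k = "x \<circ> tree_conj ?ri (inv_into UNIV x)"
    have "?k \<in> S" using S x ri by (simp add: S.comp_mem S.inv_mem)
    moreover have "?k y = r y" if "prefix z y" for y
    proof -
      have "inv_into UNIV ?ri = r"
        using r_aut by (simp add: tree_auts_def inv_inv_eq)
      then have "?k y = tree_conj x ?ri (r y)" by (simp add: tree_conj_def)
      moreover have "supported_below (x z) (tree_conj x ?ri)"
        using supported_below_conj[OF S.auts[OF x(1)]] supported_below_inv[OF r_aut] r
        by (simp add: deep_rist_iff)
      moreover have "prefix z (r y)"
        using supported_below_prefix[OF r_aut _ that] r by (simp add: deep_rist_iff)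
      then have "\<not> prefix (x z) (r y)"
        using prefix_same_length_eq[of z "r y" "x z"] x(2) tree_aut_length[OF S.auts[OF x(1)]]
        by metis
      ultimately show ?thesis by (simp add: supported_below_def)
    qed
    ultimately show ?thesis by blast
  qed
  have "r \<circ> s = s \<circ> r" if rs: "r \<in> deep_rist z" "s \<in> deep_rist z" for r s
  proof
    fix y
    have aut: "r \<in> tree_auts" "s \<in> tree_auts" using rs sub K.auts by auto
    have supp: "supported_below z r" "supported_below z s" using rs by (auto simp: deep_rist_iff)
    obtain k where k: "k \<in> P" "\<And>y. prefix z y \<Longrightarrow> k y = r y"
      using commutator[OF P p(1) pz rs(1)] by blast
    obtain l where l: "l \<in> Q" "\<And>y. prefix z y \<Longrightarrow> l y = s y"
      using commutator[OF Q q qz rs(2)] by blast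
    show "(r \<circ> s) y = (s \<circ> r) y"
    proof (cases "prefix z y")
      case True
      then have "prefix z (r y)" "prefix z (s y)"
        using supported_below_prefix aut supp by auto
      then have "(r \<circ> s) y = (k \<circ> l) y" "(s \<circ> r) y = (l \<circ> k) y" using k l True by auto
      then show ?thesis using comm[OF k(1) l(1)] by simp
    next
      case False
      then show ?thesis using supp by (simp add: supported_below_def)
    qed
  qed
  then show False using deep_rist_nonabelian[of z] by blast
qed

text \<open>The vertex map \<open>f\<close> sends \<open>v\<close> to the unique vertex of its level below which \<open>\<phi> ` deep_rist v\<close> acts
  nontrivially; uniqueness is a count, as \<open>f\<close> is injective on each finite level. Conjugation by
  \<open>\<phi> g\<close> carries the image group of \<open>v\<close> to that of \<open>g v\<close>, and hence \<open>f (g v) = \<phi> g (f v)\<close>.\<close>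

lemma Auto_is_conj:
  assumes \<phi>: "\<phi> \<in> carrier (AutoGroup (as_group G))"
  shows "\<exists>f\<in>tree_auts. \<forall>g\<in>G. \<phi> g = tree_conj f g"
proof -
  have \<phi>_comp: "\<phi> (x \<circ> y) = \<phi> x \<circ> \<phi> y" if "x \<in> G" "y \<in> G" for x y
    using Auto_comp[OF \<phi> that] .
  have \<phi>_mem: "\<phi> x \<in> G" if "x \<in> G" for x
    using Auto_mem[OF \<phi> that] .
  have \<phi>_inj: "\<phi> x = \<phi> y \<longleftrightarrow> x = y" if "x \<in> G" "y \<in> G" for x y
    using \<phi> that by (auto simp: Auto_iff bij_betw_def inj_on_eq_iff)
  have \<phi>_H: "\<phi> ` H n = H n" for n
    using \<phi> H_char by (simp add: characteristic_def)
  have \<phi>_id: "\<phi> id = id" using Auto_id[OF \<phi>] .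
  have \<phi>_inv: "\<phi> (inv_into UNIV x) = inv_into UNIV (\<phi> x)" if "x \<in> G" for x
    using Auto_inv[OF \<phi> that] .
  have \<phi>_conj: "\<phi> (tree_conj x y) = tree_conj (\<phi> x) (\<phi> y)" if "x \<in> G" "y \<in> G" for x y
    using that by (simp add: tree_conj_def \<phi>_comp \<phi>_inv comp_mem inv_mem)

  define Q where "Q v = \<phi> ` deep_rist v" for v
  have D_mem: "x \<in> G" if "x \<in> deep_rist v" for x v using that by (rule deep_rist_mem)
  have Q_H: "x \<in> H (length v)" if "x \<in> Q v" for x v
    using that \<phi>_H[of "length v"] by (auto simp: Q_def deep_rist_iff)
  have Q_group: "tree_group (Q v)" for v
  proof -
    interpret D: tree_group "deep_rist v" by (rule deep_rist_group)
    have "subgroup (Q v) (as_group G)"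
    proof (rule as_group_subgroupI)
      show "Q v \<subseteq> G" using Q_H H_mem by blast
      show "id \<in> Q v" using D.id_mem \<phi>_id by (force simp: Q_def)
      show "x \<circ> y \<in> Q v" if xy: "x \<in> Q v" "y \<in> Q v" for x y
      proof -
        obtain r s where rs: "r \<in> deep_rist v" "s \<in> deep_rist v" "x = \<phi> r" "y = \<phi> s"
          using xy unfolding Q_def by blast
        then have "x \<circ> y = \<phi> (r \<circ> s)" using \<phi>_comp[OF D_mem D_mem] by simp
        then show ?thesis using D.comp_mem[OF rs(1,2)] unfolding Q_def by blast
      qed
      show "inv_into UNIV x \<in> Q v" if x: "x \<in> Q v" for x
      proof -
        obtain r where r: "r \<in> deep_rist v" "x = \<phi> r" using x unfolding Q_def by blast
        then have "inv_into UNIV x = \<phi> (inv_into UNIV r)" using \<phi>_inv[OF D_mem] by simp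
        then show ?thesis using D.inv_mem[OF r(1)] unfolding Q_def by blast
      qed
    qed
    then show ?thesis by (rule subgroup_tree_group)
  qed
  have Q_conj: "tree_conj (\<phi> g) x \<in> Q (g v)" if g: "g \<in> G" and x: "x \<in> Q v" for g x v
  proof -
    obtain r where r: "r \<in> deep_rist v" "x = \<phi> r" using x unfolding Q_def by blast
    then have "tree_conj (\<phi> g) x = \<phi> (tree_conj g r)" using \<phi>_conj[OF g D_mem] by simp
    then show ?thesis using deep_rist_conj[OF g r(1)] unfolding Q_def by blast
  qed
  have Q_normal: "tree_conj h x \<in> Q v" if h: "h \<in> H (length v)" and x: "x \<in> Q v" for h x v
  proof -
    obtain h' where "h' \<in> H (length v)" "h = \<phi> h'" using \<phi>_H h by blast
    then show ?thesis using Q_conj[OF H_mem x, of h'] H_fixes[of h' "length v" v] by simp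
  qed
  have Q_commute: "x \<circ> y = y \<circ> x"
    if xy: "x \<in> Q v" "y \<in> Q v'" and vv': "length v = length v'" "v \<noteq> v'" for x y v v'
  proof -
    obtain r s where rs: "r \<in> deep_rist v" "x = \<phi> r" "s \<in> deep_rist v'" "y = \<phi> s"
      using xy by (auto simp: Q_def)
    have G: "r \<in> G" "s \<in> G" using rs D_mem by blast+
    have "supported_below v r" "supported_below v' s"
      using rs by (simp_all add: deep_rist_iff)
    then have "r \<circ> s = s \<circ> r"
      using supported_below_commute[OF auts[OF G(1)] auts[OF G(2)] _ _ vv'] by blast
    then show ?thesis using rs(2,4) \<phi>_comp[OF G] \<phi>_comp[OF G(2,1)] by simp
  qed
  have Q_disjoint: "v = v'" if "moves_below (Q v) w" "moves_below (Q v') w"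
    "length v = length w" "length v' = length w" for v v' w
  proof (rule ccontr)
    assume "v \<noteq> v'"
    show False
    proof (rule commuting_normal_subgroups_disjoint[OF Q_group[of v] _ Q_group[of v'] _ _ that(1,2)])
      show "tree_conj h x \<in> Q v" if "h \<in> H (length w)" "x \<in> Q v" for h x
        using Q_normal that \<open>length v = length w\<close> by simp
      show "tree_conj h x \<in> Q v'" if "h \<in> H (length w)" "x \<in> Q v'" for h x
        using Q_normal that \<open>length v' = length w\<close> by simp
      show "x \<circ> y = y \<circ> x" if "x \<in> Q v" "y \<in> Q v'" for x y
        using Q_commute[OF that] \<open>v \<noteq> v'\<close> \<open>length v = length w\<close> \<open>length v' = length w\<close> by simp
    qed
  qed
  have Q_moves: "\<exists>w. length w = length v \<and> moves_below (Q v) w" for v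
  proof -
    obtain r where r: "r \<in> deep_rist v" "r \<noteq> id" using deep_rist_nontrivial by blast
    then have "\<phi> r \<noteq> id" using \<phi>_inj[of r id] \<phi>_id D_mem id_mem by auto
    then obtain u where u: "\<phi> r u \<noteq> u" by (auto simp: fun_eq_iff)
    have rH: "\<phi> r \<in> H (length v)" using r Q_H by (simp add: Q_def)
    have "length v \<le> length u"
    proof (rule ccontr)
      assume "\<not> length v \<le> length u"
      then have "\<phi> r \<in> H (length u)" using rH H_antimono[of "length u" "length v"] by auto
      then show False using u H_fixes by blast
    qed
    then have "length (take (length v) u) = length v" by simp
    moreover have "moves_below (Q v) (take (length v) u)"
      using u r(1) append_take_drop_id[of "length v" u] by (metis moves_below_def Q_def imageI)
    ultimately show ?thesis by blast
  qed
  define f where "f v = (SOME w. length w = length v \<and> moves_below (Q v) w)" for v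
  have f: "length (f v) = length v" "moves_below (Q v) (f v)" for v
    using someI_ex[OF Q_moves[of v]] by (auto simp: f_def)
  have f_inj: "u = v" if "length u = length v" "f u = f v" for u v
    using Q_disjoint[of u "f v" v] f that by metis
  have f_surj: "\<exists>v. length v = length w \<and> f v = w" for w
  proof -
    let ?L = "{u :: vertex. length u = length w}"
    have "finite ?L" using finite_lists_length_eq[of "UNIV :: bool set"] by simp
    moreover have "f ` ?L \<subseteq> ?L" using f by auto
    moreover have "inj_on f ?L" using f_inj by (auto simp: inj_on_def)
    ultimately have "f ` ?L = ?L" by (simp add: endo_inj_surj)
    then have "w \<in> f ` ?L" by simp
    then show ?thesis by auto
  qed
  have f_unique: "f v = w" if w: "length w = length v" "moves_below (Q v) w" for v w
  proof -
    obtain v' where v': "length v' = length w" "f v' = w" using f_surj by blast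
    then have "v = v'" using Q_disjoint[of v w v'] w f(2)[of v'] by auto
    then show ?thesis using v' by simp
  qed
  have f_prefix: "prefix (f v) (f w)" if "prefix v w" for v w
  proof -
    have le: "length v \<le> length w" using that by (rule prefix_length_le)
    let ?t = "take (length v) (f w)"
    have "moves_below (Q v) ?t"
    proof -
      obtain q u where q: "q \<in> Q w" "q (f w @ u) \<noteq> f w @ u"
        using f(2)[of w] by (auto simp: moves_below_def)
      have "q \<in> Q v" using q(1) deep_rist_mono[OF that] by (auto simp: Q_def)
      moreover have "f w @ u = ?t @ (drop (length v) (f w) @ u)" by simp
      ultimately show ?thesis using q(2) by (metis moves_below_def)
    qed
    then have "f v = ?t" using f_unique le f(1) by simp
    then show ?thesis by (simp add: take_is_prefix)
  qed
  have f_aut: "f \<in> tree_auts"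
  proof (rule tree_autI')
    show "u = v" if "length u = n" "length v = n" "f u = f v" for n u v
      using f_inj that by simp
    show "f [] = []" using f(1)[of "[]"] by simp
    fix u x
    obtain t where t: "f (u @ [x]) = f u @ t" using f_prefix[of u "u @ [x]"] by (auto simp: prefix_def)
    then have "length t = 1" using f(1)[of "u @ [x]"] f(1)[of u] by simp
    then show "\<exists>y. f (u @ [x]) = f u @ [y]" using t by (cases t) auto
  qed
  have "f (g v) = \<phi> g (f v)" if g: "g \<in> G" for g v
  proof (rule f_unique)
    have \<phi>g: "\<phi> g \<in> tree_auts" using g \<phi>_mem auts by blast
    show "length (\<phi> g (f v)) = length (g v)"
      using g f auts by (simp add: tree_aut_length \<phi>g)
    obtain q u where q: "q \<in> Q v" "q (f v @ u) \<noteq> f v @ u"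
      using f(2)[of v] by (auto simp: moves_below_def)
    let ?q = "tree_conj (\<phi> g) q"
    have "?q (\<phi> g (f v @ u)) \<noteq> \<phi> g (f v @ u)"
      using q(2) \<phi>g by (simp add: tree_conj_apply tree_aut_eq_iff)
    then show "moves_below (Q (g v)) (\<phi> g (f v))"
      using Q_conj[OF g q(1)] tree_section_eq[OF \<phi>g, of "f v" u] by (metis moves_below_def)
  qed
  then have "\<phi> g = tree_conj f g" if "g \<in> G" for g
    using that tree_conj_eq_iff[OF f_aut, of g "\<phi> g"] by (auto simp: fun_eq_iff)
  then show ?thesis using f_aut by blast
qed

theorem conj_map_iso:
  "conj_map G \<in> iso (as_group (normalizer AutT G)) (AutoGroup (as_group G))"
proof -
  have N: "g \<in> tree_auts" "tree_conj g ` G = G" if "g \<in> normalizer AutT G" for g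
    using that by (auto simp: normalizer_iff)
  have "conj_map G \<in> hom (as_group (normalizer AutT G)) (AutoGroup (as_group G))"
  proof (rule homI)
    fix g assume "g \<in> carrier (as_group (normalizer AutT G))"
    then show "conj_map G g \<in> carrier (AutoGroup (as_group G))" using conj_map_Auto by simp
  next
    fix g h assume "g \<in> carrier (as_group (normalizer AutT G))"
      "h \<in> carrier (as_group (normalizer AutT G))"
    then have gh: "g \<in> normalizer AutT G" "h \<in> normalizer AutT G" by auto
    have "conj_map G (g \<circ> h) = compose G (conj_map G g) (conj_map G h)"
      using N[OF gh(1)] N[OF gh(2)]
      by (auto simp: conj_map_eq tree_auts_comp compose_def fun_eq_iff restrict_def
          simp flip: tree_conj_conj)
    then show "conj_map G (g \<otimes>\<^bsub>as_group (normalizer AutT G)\<^esub> h) =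
        conj_map G g \<otimes>\<^bsub>AutoGroup (as_group G)\<^esub> conj_map G h"
      using gh conj_map_Auto by (simp add: Auto_mult AutT_simps)
  qed
  moreover have "inj_on (conj_map G) (normalizer AutT G)"
  proof (rule inj_onI)
    fix g h assume gh: "g \<in> normalizer AutT G" "h \<in> normalizer AutT G"
      "conj_map G g = conj_map G h"
    have hi: "inv_into UNIV h \<in> tree_auts" using N(1)[OF gh(2)] by (rule tree_auts_inv)
    let ?t = "inv_into UNIV h \<circ> g"
    have "tree_conj g x = tree_conj h x" if "x \<in> G" for x
      using gh N(1) that by (metis conj_map_eq restrict_apply')
    then have "tree_conj ?t x = x" if "x \<in> G" for x
      using that N(1) gh hi tree_conj_inv_cancel[OF hi, of x]
      by (simp flip: tree_conj_conj add: tree_auts_def inv_inv_eq)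
    then have "?t = id"
      using trivial_centralizer[OF rist_nontrivial] tree_auts_comp[OF hi N(1)[OF gh(1)]] by blast
    then have "h (?t u) = h u" for u by simp
    then show "g = h" using tree_aut_inv_right[OF N(1)[OF gh(2)]] by auto
  qed
  moreover have "conj_map G ` normalizer AutT G = carrier (AutoGroup (as_group G))"
  proof
    show "conj_map G ` normalizer AutT G \<subseteq> carrier (AutoGroup (as_group G))"
      using conj_map_Auto by blast
    show "carrier (AutoGroup (as_group G)) \<subseteq> conj_map G ` normalizer AutT G"
    proof
      fix \<phi> assume \<phi>: "\<phi> \<in> carrier (AutoGroup (as_group G))"
      then obtain f where f: "f \<in> tree_auts" "\<And>g. g \<in> G \<Longrightarrow> \<phi> g = tree_conj f g"
        using Auto_is_conj by blast
      have "tree_conj f ` G = \<phi> ` G" using f(2) by auto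
      then have "f \<in> normalizer AutT G"
        using \<phi> f(1) by (simp add: normalizer_iff Auto_iff bij_betw_def)
      moreover have "\<phi> = conj_map G f"
        using \<phi> f by (auto simp: conj_map_eq Auto_iff extensional_def fun_eq_iff)
      ultimately show "\<phi> \<in> conj_map G ` normalizer AutT G" by blast
    qed
  qed
  ultimately show ?thesis by (simp add: iso_def bij_betw_def)
qed

end

lemma (in tree_group) level_stabilizer_antimono:
  assumes "m \<le> n"
  shows "level_stabilizer G n \<subseteq> level_stabilizer G m"
proof
  fix g assume g: "g \<in> level_stabilizer G n"
  have "g v = v" if "length v = m" for v
  proof (rule ccontr)
    assume "g v \<noteq> v"
    then have "g (v @ replicate (n - m) False) \<noteq> v @ replicate (n - m) False"
      using tree_aut_moves_extension g auts by (auto simp: level_stabilizer_def)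
    then show False using g that assms by (auto simp: level_stabilizer_def)
  qed
  then show "g \<in> level_stabilizer G m" using g by (simp add: level_stabilizer_def)
qed

text \<open>Witnesses of saturation become a decreasing chain when the \<open>n\<close>-th one is replaced by the
  subgroup generated by all later ones, which fix level \<open>n\<close> as well.\<close>

lemma saturated_chain_exists:
  assumes sat: "saturated G" and rist: "\<And>v. \<exists>r\<in>rigid_stabilizer G v. r \<noteq> id"
  shows "\<exists>H. saturated_chain G H"
proof -
  interpret tree_group G
    using sat unfolding saturated_def by (intro tree_group.intro) (rule conjunct1)
  have "\<forall>n. \<exists>H. H \<subseteq> level_stabilizer G n \<and> characteristic H (as_group G) \<and>
      (\<forall>v m. length v = n \<longrightarrow> acts_transitively_on H {v @ w | w. length w = m})"
    using sat unfolding saturated_def by (rule conjunct2)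
  from choice[OF this] obtain K where K: "\<And>n. K n \<subseteq> level_stabilizer G n" "\<And>n. characteristic (K n) (as_group G)"
    "\<And>v m. acts_transitively_on (K (length v)) {v @ w | w. length w = m}"
    by blast
  define S where "S n = (\<Union>k\<in>{n..}. K k)" for n
  define H where "H n = generate (as_group G) (S n)" for n
  have S_stab: "S n \<subseteq> level_stabilizer G n" for n
    using K(1) level_stabilizer_antimono[of n] unfolding S_def by blast
  then have S_sub: "S n \<subseteq> G" for n by (auto simp: level_stabilizer_def)
  have "saturated_chain G H"
  proof unfold_locales
    show "H n \<subseteq> level_stabilizer G n" for n
      unfolding H_def using S_stab subgroup_level_stabilizer
      by (rule group.generate_subgroup_incl[OF group_as_group])
    show "characteristic (H n) (as_group G)" for n
      unfolding H_def
    proof (rule characteristic_generate[OF S_sub])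
      fix \<phi> assume "\<phi> \<in> carrier (AutoGroup (as_group G))"
      then show "\<phi> ` S n = S n" using K(2) by (auto simp: S_def image_UN characteristic_def)
    qed
    show "H n \<subseteq> H m" if "m \<le> n" for m n
      unfolding H_def using that
      by (intro group.mono_generate[OF group_as_group]) (fastforce simp: S_def)
    show "\<exists>h\<in>H (length v). h (v @ w) = v @ w'" if len: "length w = length w'" for v w w'
    proof -
      have "v @ w \<in> {v @ u | u. length u = length w}" "v @ w' \<in> {v @ u | u. length u = length w}"
        using len by auto
      then obtain h where "h \<in> K (length v)" "h (v @ w) = v @ w'"
        using K(3)[of v "length w"] unfolding acts_transitively_on_def by blast
      moreover have "K (length v) \<subseteq> H (length v)"
        by (auto simp: H_def S_def intro: generate.incl)
      ultimately show ?thesis by blast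
    qed
  qed (rule rist)
  then show ?thesis by blast
qed

text \<open>The rigidity theorem of Lavreniuk and Nekrashevych for weakly branch groups; level transitivity
  is contained in saturation at level 0.\<close>

theorem saturated_conj_map_iso:
  assumes "saturated G" "\<And>v. \<exists>r\<in>rigid_stabilizer G v. r \<noteq> id"
  shows "conj_map G \<in> iso (as_group (normalizer AutT G)) (AutoGroup (as_group G))"
  using saturated_chain_exists[OF assms] saturated_chain.conj_map_iso by blast

section \<open>Saturation by powers of an odometer\<close>

lemma square_fixes_next_level:
  assumes "g \<in> tree_auts" "g u = u"
  shows "g (g (u @ [l])) = u @ [l]"
proof -
  obtain k where k: "g (u @ [l]) = u @ [k]" using tree_aut_extends[OF assms(1), of u l] assms(2) by auto
  obtain k' where k': "g (u @ [\<not> l]) = u @ [k']"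
    using tree_aut_extends[OF assms(1), of u "\<not> l"] assms(2) by auto
  have "k \<noteq> k'" using tree_aut_eq_iff[OF assms(1), of "u @ [l]" "u @ [\<not> l]"] k k' by auto
  then have "k = l \<or> k = (\<not> l) \<and> k' = l" by auto
  then show ?thesis using k k' by auto
qed

lemma power_fixes_level:
  assumes "g \<in> tree_auts" "length v = n"
  shows "(g ^^ (2 ^ n)) v = v"
  using assms(2)
proof (induction n arbitrary: v)
  case 0
  then show ?case using assms(1) by (simp add: tree_auts_def)
next
  case (Suc n)
  then obtain u l where v: "v = u @ [l]" "length u = n" by (metis length_Suc_conv_rev)
  interpret T: tree_group tree_auts
    using group.subgroup_self[OF group_AutT] by (simp add: tree_group_def AutT_simps)
  have "(g ^^ (2 ^ n)) ((g ^^ (2 ^ n)) v) = v"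
    using square_fixes_next_level[OF T.funpow_mem[OF assms(1)] Suc.IH[OF v(2)]] by (simp add: v(1))
  then show ?case by (simp add: mult_2 funpow_add)
qed

text \<open>An element acting on every level as a single cycle, expressed through its powers: the powers
  of \<open>g ^^ 2 ^ n\<close> are transitive on each level of each subtree at level \<open>n\<close>. The case of the root is
  transitivity of the powers of \<open>g\<close> on all levels.\<close>

definition odometer :: "(vertex \<Rightarrow> vertex) \<Rightarrow> bool" where
  "odometer g \<longleftrightarrow> (\<forall>v w w'. length w = length w' \<longrightarrow> (\<exists>k. (g ^^ (2 ^ length v * k)) (v @ w) = v @ w'))"

lemma fixed_vertex_subtree_image:
  assumes "h \<in> tree_auts" "h v = v"
  shows "h ` {v @ w | w. length w = m} = {v @ w | w. length w = m}"
proof -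
  have sub: "g ` {v @ w | w. length w = m} \<subseteq> {v @ w | w. length w = m}"
    if "g \<in> tree_auts" "g v = v" for g
  proof
    fix y assume "y \<in> g ` {v @ w | w. length w = m}"
    then obtain w where w: "length w = m" "y = g (v @ w)" by auto
    then show "y \<in> {v @ w | w. length w = m}"
      using tree_section_eq[OF that(1), of v w] that tree_aut_length[OF that(1), of "v @ w"] by auto
  qed
  have "inv_into UNIV h v = v" using assms tree_aut_inv_left by metis
  then have "inv_into UNIV h ` {v @ w | w. length w = m} \<subseteq> {v @ w | w. length w = m}"
    using sub tree_auts_inv[OF assms(1)] by blast
  then have "y \<in> h ` {v @ w | w. length w = m}" if "y \<in> {v @ w | w. length w = m}" for y
    using tree_aut_inv_right[OF assms(1), of y, symmetric] that by (blast intro: image_eqI)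
  then have "{v @ w | w. length w = m} \<subseteq> h ` {v @ w | w. length w = m}" by (rule subsetI)
  then show ?thesis using sub assms by blast
qed

text \<open>The witness for level \<open>n\<close> is the subgroup generated by all \<open>2 ^ n\<close>-th powers.\<close>

theorem (in tree_group) odometer_saturated:
  assumes g: "g \<in> G" "odometer g"
  shows "saturated G"
  unfolding saturated_def
proof (intro conjI allI)
  show "subgroup G AutT" by (rule sub)
  fix n
  let ?S = "{x ^^ (2 ^ n) | x. x \<in> G}"
  let ?H = "generate (as_group G) ?S"
  have S: "?S \<subseteq> G" using funpow_mem by auto
  have "?S \<subseteq> level_stabilizer G n"
    using power_fixes_level auts funpow_mem by (auto simp: level_stabilizer_def)
  then have stab: "?H \<subseteq> level_stabilizer G n"
    using group.generate_subgroup_incl[OF group_as_group _ subgroup_level_stabilizer] by blast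
  have "characteristic ?H (as_group G)"
  proof (rule characteristic_generate[OF S])
    fix \<phi> assume \<phi>: "\<phi> \<in> carrier (AutoGroup (as_group G))"
    then have "\<phi> ` G = G" by (auto simp: Auto_iff bij_betw_def)
    moreover have "\<phi> ` ?S = {x ^^ (2 ^ n) | x. x \<in> \<phi> ` G}"
      using Auto_funpow[OF \<phi>] by (auto simp: image_iff) metis+
    ultimately show "\<phi> ` ?S = ?S" by simp
  qed
  moreover have "acts_transitively_on ?H {v @ w | w. length w = m}" if v: "length v = n" for v m
    unfolding acts_transitively_on_def
  proof (intro conjI ballI)
    fix h assume "h \<in> ?H"
    then have "h \<in> G" "h v = v" using stab v by (auto simp: level_stabilizer_def)
    then show "h ` {v @ w | w. length w = m} = {v @ w | w. length w = m}"
      using fixed_vertex_subtree_image auts by blast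
  next
    fix x y assume "x \<in> {v @ w | w. length w = m}" "y \<in> {v @ w | w. length w = m}"
    then obtain w w' where w: "x = v @ w" "y = v @ w'" "length w = length w'" by auto
    have "\<exists>k. (g ^^ (2 ^ length v * k)) (v @ w) = v @ w'" using g(2) w(3) by (simp add: odometer_def)
    then obtain k where "(g ^^ (2 ^ n * k)) x = y" using v w(1,2) by auto
    then have k: "((g ^^ k) ^^ (2 ^ n)) x = y" by (simp add: funpow_mult mult.commute)
    have "(g ^^ k) ^^ (2 ^ n) \<in> ?S" using funpow_mem[OF g(1), of k] by blast
    then have "(g ^^ k) ^^ (2 ^ n) \<in> ?H" by (rule generate.incl)
    then show "\<exists>h\<in>?H. h x = y" using k by blast
  qed
  ultimately show "\<exists>H\<subseteq>level_stabilizer G n. characteristic H (as_group G) \<and>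
        (\<forall>v m. length v = n \<longrightarrow> acts_transitively_on H {v @ w | w. length w = m})"
    using stab by blast
qed

text \<open>The square of \<open>g = (x, y) \<tau>\<close> acts as \<open>x y\<close> below the letter 0, and \<open>g\<close> interchanges the two
  halves of the tree. So if \<open>x y\<close> is an odometer then \<open>g\<close> is one, and membership in \<open>P\<close> supplies the
  induction hypothesis one level down. Words beginning with 1 are reduced to words beginning with 0
  by applying \<open>g\<close> once.\<close>

lemma odometer_coinduct:
  assumes "g \<in> P"
    and step: "\<And>g. g \<in> P \<Longrightarrow>
      \<exists>x y. g = wr x y \<circ> swap_letter \<and> x \<in> tree_auts \<and> y \<in> tree_auts \<and> x \<circ> y \<in> P"
  shows "odometer g"
proof -
  have funpow2: "(h ^^ (2 * k)) (False # u) = False # ((x \<circ> y) ^^ k) u"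
    if "h = wr x y \<circ> swap_letter" for h x y k u
    using that by (induction k) auto
  have trans: "\<exists>k. (h ^^ k) u = u'" if "length u = n" "length u' = n" "h \<in> P" for n h u u'
    using that
  proof (induction n arbitrary: h u u')
    case 0
    then show ?case by (intro exI[of _ 0]) simp
  next
    case (Suc n)
    obtain x y where h: "h = wr x y \<circ> swap_letter" and x: "x \<in> tree_auts" and y: "y \<in> tree_auts"
      and xy: "x \<circ> y \<in> P" using step[OF \<open>h \<in> P\<close>] by blast
    have join: "\<exists>k. (h ^^ k) s = t" if "\<exists>k. (h ^^ k) s = r" "\<exists>k. (h ^^ k) r = t" for r s t
      using that by (metis funpow_add comp_apply)
    have FF: "\<exists>k. (h ^^ k) (False # s) = False # t" if "length s = n" "length t = n" for s t
      using Suc.IH[OF that xy] funpow2[OF h] by metis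
    have FT: "\<exists>k. (h ^^ k) (False # s) = True # t" if "length s = n" "length t = n" for s t
    proof (rule join)
      let ?t = "inv_into UNIV y t"
      show "\<exists>k. (h ^^ k) (False # s) = False # ?t"
        using that tree_aut_length[OF tree_auts_inv[OF y]] by (intro FF) auto
      have "(h ^^ 1) (False # ?t) = True # t" using tree_aut_inv_right[OF y] by (simp add: h)
      then show "\<exists>k. (h ^^ k) (False # ?t) = True # t" ..
    qed
    have F: "\<exists>k. (h ^^ k) (False # s) = u'" if "length s = n" for s
      using that FF FT Suc.prems(2) by (cases u' rule: word_cases) auto
    show ?case
    proof (cases u rule: word_cases)
      case 1
      then show ?thesis using Suc.prems by simp
    next
      case (2 s)
      then show ?thesis using F Suc.prems by simp
    next
      case (3 s)
      have "(h ^^ 1) u = False # x s" by (simp add: h 3)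
      then have "\<exists>k. (h ^^ k) u = False # x s" ..
      then show ?thesis
      proof (rule join)
        show "\<exists>k. (h ^^ k) (False # x s) = u'"
          using F tree_aut_length[OF x, of s] Suc.prems(1) 3 by simp
      qed
    qed
  qed
  have "\<exists>k. (h ^^ (2 ^ n * k)) (v @ w) = v @ w'"
    if "length v = n" "length w = length w'" "h \<in> P" for n h v w w'
    using that
  proof (induction n arbitrary: h v w w')
    case 0
    have "\<exists>k. (h ^^ k) w = w'" by (rule trans[OF refl 0(2)[symmetric] 0(3)])
    then show ?case using 0(1) by simp
  next
    case (Suc n)
    obtain x y where h: "h = wr x y \<circ> swap_letter" and y: "y \<in> tree_auts"
      and xy: "x \<circ> y \<in> P" using step[OF \<open>h \<in> P\<close>] by blast
    have F: "\<exists>k. (h ^^ (2 ^ Suc n * k)) (False # s @ t) = False # s @ t'"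
      if st: "length s = n" "length t = length t'" for s t t'
    proof -
      obtain k where "((x \<circ> y) ^^ (2 ^ n * k)) (s @ t) = s @ t'"
        using Suc.IH[OF st xy] by blast
      then have "(h ^^ (2 * (2 ^ n * k))) (False # s @ t) = False # s @ t'"
        by (simp add: funpow2[OF h])
      then have "(h ^^ (2 ^ Suc n * k)) (False # s @ t) = False # s @ t'"
        by (simp only: power_Suc mult.assoc)
      then show ?thesis ..
    qed
    show ?case
    proof (cases v rule: word_cases)
      case 1
      then show ?thesis using Suc.prems by simp
    next
      case (2 s)
      then show ?thesis using F[of s w w'] Suc.prems by simp
    next
      case (3 s)
      let ?i = "inv_into UNIV y"
      have i: "?i \<in> tree_auts" using y by (rule tree_auts_inv)
      have len: "length (tree_section ?i s t) = length t" for t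
        using tree_aut_length[OF i] by (simp add: tree_section_def)
      obtain k where "(h ^^ (2 ^ Suc n * k)) (False # ?i s @ tree_section ?i s w)
          = False # ?i s @ tree_section ?i s w'"
        using F[of "?i s" "tree_section ?i s w" "tree_section ?i s w'"] Suc.prems 3 len
          tree_aut_length[OF i] by auto
      then have "(h ^^ (2 ^ Suc n * k)) (False # ?i (s @ w)) = False # ?i (s @ w')"
        by (simp only: tree_section_eq[OF i])
      then have "(h ^^ (2 ^ Suc n * k)) (h (False # ?i (s @ w))) = h (False # ?i (s @ w'))"
        by (metis funpow_swap1)
      moreover have "h (False # ?i t) = True # t" for t
        using tree_aut_inv_right[OF y] by (simp add: h)
      ultimately show ?thesis using 3 by auto
    qed
  qed
  then show ?thesis using \<open>g \<in> P\<close> by (simp add: odometer_def)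
qed

section \<open>The second Basilica group\<close>

interpretation B: tree_group basilica2
  by (simp add: tree_group_def subgroup_basilica2)

lemma wr_comp: "wr x y \<circ> wr x' y' = wr (x \<circ> x') (y \<circ> y')"
proof
  fix w show "(wr x y \<circ> wr x' y') w = wr (x \<circ> x') (y \<circ> y') w"
    by (cases w rule: word_cases) auto
qed

lemma wr_id: "wr id id = id"
  by (rule wr_eqI[symmetric]) auto

lemma swap_comp_wr: "swap_letter \<circ> wr x y = wr y x \<circ> swap_letter"
proof
  fix w show "(swap_letter \<circ> wr x y) w = (wr y x \<circ> swap_letter) w"
    by (cases w rule: word_cases) auto
qed

lemma swap_swap: "swap_letter \<circ> swap_letter = id"
proof
  fix w show "(swap_letter \<circ> swap_letter) w = id w"
    by (cases w rule: word_cases) auto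
qed

lemma gen_a_eq: "gen_a = swap_letter"
  by (simp add: gen_a_def wr_id)

lemma wr_funpow: "wr x y ^^ k = wr (x ^^ k) (y ^^ k)"
proof (induction k)
  case 0
  then show ?case by (simp only: funpow.simps wr_id)
next
  case (Suc k)
  then show ?case by (simp only: funpow.simps wr_comp)
qed

lemma generators_mem:
  "gen_a \<in> basilica2" "gen_alpha \<in> basilica2" "gen_c0 \<in> basilica2" "gen_c1 \<in> basilica2"
  "gen_c2 \<in> basilica2" "gen_c3 \<in> basilica2"
  unfolding basilica2_def by (auto intro: generate.incl)

lemma gen_a_involution: "gen_a \<circ> gen_a = id"
  by (simp add: gen_a_eq swap_swap)

lemma gen_alpha_involution: "gen_alpha \<circ> gen_alpha = id"
  by (simp add: gen_alpha_def wr_comp gen_a_involution wr_id)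

lemma gen_c_involution:
  "gen_c0 \<circ> gen_c0 = id" "gen_c1 \<circ> gen_c1 = id" "gen_c2 \<circ> gen_c2 = id" "gen_c3 \<circ> gen_c3 = id"
proof -
  have "gen_alpha (gen_alpha w) = w" for w using gen_alpha_involution by (metis comp_apply id_apply)
  then have "gen_c0 (gen_c0 w) = w" "gen_c1 (gen_c1 w) = w" "gen_c2 (gen_c2 w) = w"
    "gen_c3 (gen_c3 w) = w" for w
    by (induction w and w and w and w rule: gen_c0_gen_c1_gen_c2_gen_c3.induct) simp_all
  then show "gen_c0 \<circ> gen_c0 = id" "gen_c1 \<circ> gen_c1 = id" "gen_c2 \<circ> gen_c2 = id"
    "gen_c3 \<circ> gen_c3 = id" by auto
qed

lemma inv_AutT_involution: "g \<circ> g = id \<Longrightarrow> g \<in> tree_auts \<Longrightarrow> inv\<^bsub>AutT\<^esub> g = g"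
  by (simp add: inv_AutT inv_unique_comp)

text \<open>The wreath recursion shifts the indices cyclically, so below the letter 0 each rotation of
  \<open>c\<^sub>0 c\<^sub>1 c\<^sub>2 c\<^sub>3\<close> acts as the next one; below the letter 1 only the factor \<open>c\<^sub>3\<close> acts, as \<open>\<alpha>\<close>.\<close>

definition c_product_rotations :: "(vertex \<Rightarrow> vertex) set" where
  "c_product_rotations =
    {gen_c0 \<circ> gen_c1 \<circ> gen_c2 \<circ> gen_c3, gen_c1 \<circ> gen_c2 \<circ> gen_c3 \<circ> gen_c0,
     gen_c2 \<circ> gen_c3 \<circ> gen_c0 \<circ> gen_c1, gen_c3 \<circ> gen_c0 \<circ> gen_c1 \<circ> gen_c2}"

lemma c_product_mem: "c \<in> c_product_rotations \<Longrightarrow> c \<in> basilica2"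
  by (auto simp: c_product_rotations_def intro!: B.comp_mem generators_mem)

lemma c_product_wr:
  assumes "c \<in> c_product_rotations"
  shows "\<exists>c'\<in>c_product_rotations. c = wr c' gen_alpha"
proof -
  have "gen_c0 \<circ> gen_c1 \<circ> gen_c2 \<circ> gen_c3 = wr (gen_c1 \<circ> gen_c2 \<circ> gen_c3 \<circ> gen_c0) gen_alpha"
    "gen_c1 \<circ> gen_c2 \<circ> gen_c3 \<circ> gen_c0 = wr (gen_c2 \<circ> gen_c3 \<circ> gen_c0 \<circ> gen_c1) gen_alpha"
    "gen_c2 \<circ> gen_c3 \<circ> gen_c0 \<circ> gen_c1 = wr (gen_c3 \<circ> gen_c0 \<circ> gen_c1 \<circ> gen_c2) gen_alpha"
    "gen_c3 \<circ> gen_c0 \<circ> gen_c1 \<circ> gen_c2 = wr (gen_c0 \<circ> gen_c1 \<circ> gen_c2 \<circ> gen_c3) gen_alpha"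
    by (rule wr_eqI; simp)+
  then show ?thesis using assms unfolding c_product_rotations_def by blast
qed

definition basilica2_odometers :: "(vertex \<Rightarrow> vertex) set" where
  "basilica2_odometers = (\<Union>c\<in>c_product_rotations. {c \<circ> gen_alpha \<circ> gen_a, c \<circ> gen_a \<circ> gen_alpha})"

text \<open>Here \<open>c \<alpha> a = (c' a, \<alpha>) \<tau>\<close> leads to \<open>c' a \<alpha>\<close>, and \<open>c a \<alpha> = (c', \<alpha> a) \<tau>\<close> leads to \<open>c' \<alpha> a\<close>.\<close>

lemma basilica2_odometer:
  assumes "g \<in> basilica2_odometers"
  shows "odometer g"
  using assms
proof (rule odometer_coinduct)
  fix g assume "g \<in> basilica2_odometers"
  then obtain c where c: "c \<in> c_product_rotations"
    "g = c \<circ> gen_alpha \<circ> gen_a \<or> g = c \<circ> gen_a \<circ> gen_alpha"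
    by (auto simp: basilica2_odometers_def)
  obtain c' where c': "c' \<in> c_product_rotations" "c = wr c' gen_alpha"
    using c_product_wr[OF c(1)] by blast
  have aut: "c' \<in> tree_auts" using c'(1) c_product_mem B.auts by blast
  from c(2) show "\<exists>x y. g = wr x y \<circ> swap_letter \<and> x \<in> tree_auts \<and> y \<in> tree_auts \<and>
      x \<circ> y \<in> basilica2_odometers"
  proof
    assume "g = c \<circ> gen_alpha \<circ> gen_a"
    then have "g = wr (c' \<circ> gen_a) gen_alpha \<circ> swap_letter"
      by (simp add: c' gen_alpha_def wr_comp gen_a_eq)
    moreover have "c' \<circ> gen_a \<circ> gen_alpha \<in> basilica2_odometers"
      using c'(1) by (auto simp: basilica2_odometers_def)
    ultimately show ?thesis using aut gen_a_aut gen_alpha_aut tree_auts_comp by blast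
  next
    assume "g = c \<circ> gen_a \<circ> gen_alpha"
    then have "g = wr c' gen_alpha \<circ> (swap_letter \<circ> wr gen_a id)"
      by (simp add: c' gen_alpha_def gen_a_eq comp_assoc)
    then have "g = wr c' (gen_alpha \<circ> gen_a) \<circ> swap_letter"
      by (simp add: swap_comp_wr wr_comp flip: comp_assoc)
    moreover have "c' \<circ> (gen_alpha \<circ> gen_a) \<in> basilica2_odometers"
      using c'(1) by (auto simp: basilica2_odometers_def comp_assoc)
    ultimately show ?thesis using aut gen_a_aut gen_alpha_aut tree_auts_comp by blast
  qed
qed

lemma basilica2_odometer_exists: "\<exists>g\<in>basilica2. odometer g"
proof -
  obtain c where c: "c \<in> c_product_rotations" by (auto simp: c_product_rotations_def)
  then have "c \<circ> gen_alpha \<circ> gen_a \<in> basilica2"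
    using c_product_mem B.comp_mem generators_mem by blast
  moreover have "c \<circ> gen_alpha \<circ> gen_a \<in> basilica2_odometers"
    using c by (auto simp: basilica2_odometers_def)
  ultimately show ?thesis using basilica2_odometer by blast
qed

text \<open>The generators are \<open>\<alpha> = (a, 1)\<close> and \<open>c\<^sub>0 = (c\<^sub>1, 1)\<close>, so the question is about the group generated by
  \<open>a = (1, 1) \<tau>\<close> and \<open>c\<^sub>1 = (c\<^sub>2, 1)\<close>. As \<open>c\<^sub>2\<close> is an involution, this is the dihedral group of order 8, the
  wreath product \<open>\<langle>c\<^sub>2\<rangle> \<wr> \<langle>\<tau>\<rangle>\<close>, called \<open>Z\<close> below: squares lie in \<open>\<langle>c\<^sub>2\<rangle> \<times> \<langle>c\<^sub>2\<rangle>\<close>, which has exponent 2.\<close>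

lemma fourth_power_generate_alpha_c0:
  assumes "y \<in> generate AutT {gen_alpha, gen_c0}"
  shows "y ^^ 4 = id"
proof -
  let ?C = "{id, gen_c2}" and ?S = "{id, swap_letter}"
  have C: "p \<circ> q \<in> ?C" "p \<circ> p = id" if "p \<in> ?C" "q \<in> ?C" for p q
    using that by (auto simp: gen_c_involution)
  have S: "s \<circ> t \<in> ?S" if "s \<in> ?S" "t \<in> ?S" for s t
    using that by (auto simp: swap_swap)
  define Z where "Z = {wr p q \<circ> s | p q s. p \<in> ?C \<and> q \<in> ?C \<and> s \<in> ?S}"
  have Z_I: "wr p q \<circ> s \<in> Z" if "p \<in> ?C" "q \<in> ?C" "s \<in> ?S" for p q s
    using that unfolding Z_def by blast
  have Z_comp: "x \<circ> y \<in> Z" if xy: "x \<in> Z" "y \<in> Z" for x y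
  proof -
    obtain p q s where x: "p \<in> ?C" "q \<in> ?C" "s \<in> ?S" "x = wr p q \<circ> s"
      using xy(1) unfolding Z_def by blast
    obtain p' q' s' where y: "p' \<in> ?C" "q' \<in> ?C" "s' \<in> ?S" "y = wr p' q' \<circ> s'"
      using xy(2) unfolding Z_def by blast
    from x(3) consider "s = id" | "s = swap_letter" by blast
    then show ?thesis
    proof cases
      case 1
      then have "x \<circ> y = wr (p \<circ> p') (q \<circ> q') \<circ> s'"
        by (simp add: x(4) y(4) wr_comp[symmetric] comp_assoc)
      then show ?thesis using Z_I[OF C(1)[OF x(1) y(1)] C(1)[OF x(2) y(2)] y(3)] by simp
    next
      case 2
      have "swap_letter \<circ> (wr p' q' \<circ> s') = wr q' p' \<circ> (swap_letter \<circ> s')"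
        by (metis comp_assoc swap_comp_wr)
      then have "x \<circ> y = wr (p \<circ> q') (q \<circ> p') \<circ> (swap_letter \<circ> s')"
        by (simp add: x(4) y(4) 2 wr_comp[symmetric] comp_assoc)
      then show ?thesis
        using Z_I[OF C(1)[OF x(1) y(2)] C(1)[OF x(2) y(1)] S[of swap_letter s']] y(3) by simp
    qed
  qed
  have gens: "h \<in> (\<lambda>z. wr z id) ` Z" if "h \<in> {gen_alpha, gen_c0}" for h
  proof -
    have "wr id id \<circ> swap_letter \<in> Z" "wr gen_c2 id \<circ> id \<in> Z" by (intro Z_I; simp)+
    moreover have "gen_alpha = wr (wr id id \<circ> swap_letter) id"
      by (simp only: gen_alpha_def gen_a_def)
    moreover have "gen_c0 = wr (wr gen_c2 id \<circ> id) id" by (simp add: gen_c_wr(1,2))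
    ultimately show ?thesis using that by blast
  qed
  have "y \<in> (\<lambda>z. wr z id) ` Z"
    using assms
  proof induction
    case one
    have "wr id id \<circ> id \<in> Z" by (intro Z_I; simp)
    moreover have "\<one>\<^bsub>AutT\<^esub> = wr (wr id id \<circ> id) id" by (simp add: wr_id AutT_simps)
    ultimately show ?case by blast
  next
    case (incl h)
    then show ?case using gens by blast
  next
    case (inv h)
    then have "inv\<^bsub>AutT\<^esub> h = h"
      using gen_alpha_involution gen_c_involution gen_alpha_aut gen_c_aut
      by (auto intro: inv_AutT_involution)
    then show ?case using gens[OF inv] by (simp only:)
  next
    case (eng h1 h2)
    then obtain z1 z2 where z: "z1 \<in> Z" "z2 \<in> Z" "h1 = wr z1 id" "h2 = wr z2 id" by blast
    then have "h1 \<otimes>\<^bsub>AutT\<^esub> h2 = wr (z1 \<circ> z2) id" by (simp add: AutT_simps wr_comp)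
    then show ?case using Z_comp[OF z(1,2)] by blast
  qed
  then obtain p q s where pq: "p \<in> ?C" "q \<in> ?C" "s \<in> ?S" "y = wr (wr p q \<circ> s) id"
    unfolding Z_def by blast
  let ?z = "wr p q \<circ> s"
  have square: "\<exists>p'\<in>?C. \<exists>q'\<in>?C. ?z \<circ> ?z = wr p' q'"
  proof (cases "s = id")
    case True
    then have "?z \<circ> ?z = wr (p \<circ> p) (q \<circ> q)" by (simp add: wr_comp)
    then show ?thesis using C(1)[OF pq(1,1)] C(1)[OF pq(2,2)] by blast
  next
    case False
    then have s: "s = swap_letter" using pq(3) by blast
    have "?z \<circ> ?z = wr p q \<circ> (swap_letter \<circ> wr p q) \<circ> swap_letter" by (simp add: s comp_assoc)
    also have "\<dots> = wr p q \<circ> wr q p \<circ> (swap_letter \<circ> swap_letter)"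
      by (simp only: swap_comp_wr comp_assoc)
    finally have "?z \<circ> ?z = wr (p \<circ> q) (q \<circ> p)" by (simp add: swap_swap wr_comp)
    then show ?thesis using C(1)[OF pq(1,2)] C(1)[OF pq(2,1)] by blast
  qed
  then obtain p' q' where *: "p' \<in> ?C" "q' \<in> ?C" "?z \<circ> ?z = wr p' q'" by blast
  have "(?z \<circ> ?z) \<circ> (?z \<circ> ?z) = id"
    using C(2)[OF *(1,1)] C(2)[OF *(2,2)] by (simp only: *(3) wr_comp wr_id)
  then have "?z ^^ 4 = id" by (simp add: numeral_eq_Suc comp_assoc)
  then show ?thesis using pq(4) by (simp add: wr_funpow wr_id)
qed

text \<open>It suffices to lift the generators: \<open>a, c\<^sub>1, c\<^sub>2, c\<^sub>3\<close> are the first coordinates of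
  \<open>\<alpha>, c\<^sub>0, c\<^sub>1, c\<^sub>2\<close>, with second coordinate trivial; \<open>c\<^sub>0\<close> is the first coordinate of \<open>c\<^sub>3 = (c\<^sub>0, \<alpha>)\<close>, and \<open>\<alpha>\<close>
  that of \<open>a c\<^sub>3 a = (\<alpha>, c\<^sub>0)\<close>.\<close>

lemma first_coordinate_lift:
  assumes "g \<in> basilica2"
  shows "\<exists>y\<in>generate AutT {gen_alpha, gen_c0}. wr g y \<in> basilica2"
proof -
  let ?D = "generate AutT {gen_alpha, gen_c0}"
  have D: "id \<in> ?D" "gen_alpha \<in> ?D" "gen_c0 \<in> ?D" "\<And>x y. x \<in> ?D \<Longrightarrow> y \<in> ?D \<Longrightarrow> x \<circ> y \<in> ?D"
    using generate.one[of AutT] generate.incl[of _ _ AutT] generate.eng[of _ AutT]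
    by (auto simp: AutT_simps)
  have gens: "\<exists>y\<in>?D. wr h y \<in> basilica2"
    if "h \<in> {gen_a, gen_alpha, gen_c0, gen_c1, gen_c2, gen_c3}" for h
  proof -
    have "gen_a \<circ> gen_c3 \<circ> gen_a = wr gen_alpha gen_c0"
      by (rule wr_eqI) (auto simp: gen_a_eq)
    moreover have "gen_a \<circ> gen_c3 \<circ> gen_a \<in> basilica2" by (intro B.comp_mem generators_mem)
    ultimately have "wr gen_alpha gen_c0 \<in> basilica2" by simp
    moreover have "wr gen_a id \<in> basilica2" "wr gen_c1 id \<in> basilica2" "wr gen_c2 id \<in> basilica2"
      "wr gen_c3 id \<in> basilica2" "wr gen_c0 gen_alpha \<in> basilica2"
      using generators_mem by (simp_all only: gen_c_wr[symmetric] gen_alpha_def[symmetric])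
    ultimately show ?thesis using that D(1-3) by blast
  qed
  have "g \<in> generate AutT {gen_a, gen_alpha, gen_c0, gen_c1, gen_c2, gen_c3}"
    using assms by (simp only: basilica2_def)
  then show ?thesis
  proof induction
    case one
    show ?case using D(1) B.id_mem wr_id by (metis AutT_simps(3))
  next
    case (incl h)
    then show ?case by (rule gens)
  next
    case (inv h)
    then have "inv\<^bsub>AutT\<^esub> h = h"
      using gen_a_involution gen_alpha_involution gen_c_involution gen_a_aut gen_alpha_aut gen_c_aut
      by (auto intro: inv_AutT_involution)
    then show ?case using gens[OF inv] by (simp only:)
  next
    case (eng h1 h2)
    then obtain y1 y2 where y: "y1 \<in> ?D" "wr h1 y1 \<in> basilica2" "y2 \<in> ?D" "wr h2 y2 \<in> basilica2"
      by blast
    then have "wr (h1 \<circ> h2) (y1 \<circ> y2) \<in> basilica2" using B.comp_mem by (simp flip: wr_comp)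
    then show ?case using D(4)[OF y(1,3)] unfolding AutT_simps by blast
  qed
qed

text \<open>Carrying the fourth power along makes the induction work: \<open>(g, y)\<^sup>4 = (g\<^sup>4, 1)\<close> is nontrivial, is
  supported one level deeper, and is again a fourth power. An odometer provides the start, since it
  has more than four vertices in its orbit on level 3.\<close>

lemma basilica2_rigid_stabilizer_spine:
  "\<exists>g\<in>basilica2. g ^^ 4 \<noteq> id \<and> supported_below (replicate n False) (g ^^ 4)"
proof (induction n)
  case 0
  obtain g where g: "g \<in> basilica2" "odometer g" using basilica2_odometer_exists by blast
  \<comment> \<open>A power of \<open>g\<^sup>4\<close> exchanges the children of the vertex 00, so \<open>g\<^sup>4\<close> is not the identity.\<close>
  obtain k where k: "(g ^^ (2 ^ length [False, False] * k)) ([False, False] @ [False]) = [False, False] @ [True]"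
    using g(2)[unfolded odometer_def, rule_format, of "[False]" "[True]" "[False, False]"] by auto
  have "g ^^ 4 \<noteq> id"
  proof
    assume "g ^^ 4 = id"
    then have "(g ^^ 4) ^^ k = id" by (simp only: id_funpow)
    then have "g ^^ (4 * k) = id" by (simp only: funpow_mult mult.commute)
    then show False using k by (simp add: numeral_eq_Suc)
  qed
  then show ?case using g(1) by (auto simp: supported_below_def)
next
  case (Suc n)
  then obtain g where g: "g \<in> basilica2" "g ^^ 4 \<noteq> id" "supported_below (replicate n False) (g ^^ 4)"
    by blast
  obtain y where y: "y \<in> generate AutT {gen_alpha, gen_c0}" "wr g y \<in> basilica2"
    using first_coordinate_lift[OF g(1)] by blast
  have eq: "wr g y ^^ 4 = wr (g ^^ 4) id"
    using fourth_power_generate_alpha_c0[OF y(1)] by (simp add: wr_funpow)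
  have "wr (g ^^ 4) id \<noteq> id" using g(2) wr_section(1) wr_id by metis
  moreover have "wr (g ^^ 4) id u = u" if "\<not> prefix (False # replicate n False) u" for u
    using that g(3) by (cases u rule: word_cases) (auto simp: supported_below_def)
  then have "supported_below (replicate (Suc n) False) (wr (g ^^ 4) id)"
    by (simp add: supported_below_def)
  ultimately show ?case using y(2) eq by metis
qed

text \<open>Any vertex is the image of the leftmost one of its level under a power of an odometer.\<close>

lemma basilica2_weakly_branch: "\<exists>r\<in>rigid_stabilizer basilica2 v. r \<noteq> id"
proof -
  let ?o = "replicate (length v) False"
  obtain g where g: "g \<in> basilica2" "g ^^ 4 \<noteq> id" "supported_below ?o (g ^^ 4)"
    using basilica2_rigid_stabilizer_spine by blast
  obtain t where t: "t \<in> basilica2" "odometer t" using basilica2_odometer_exists by blast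
  obtain k where "(t ^^ (2 ^ length [] * k)) ([] @ ?o) = [] @ v"
    using t(2)[unfolded odometer_def, rule_format, of ?o v "[]"] by auto
  then have k: "(t ^^ k) ?o = v" by simp
  let ?h = "t ^^ k"
  have h: "?h \<in> basilica2" "?h \<in> tree_auts" using t(1) B.funpow_mem B.auts by auto
  have "tree_conj ?h (g ^^ 4) \<in> rigid_stabilizer basilica2 v"
    using supported_below_conj[OF h(2) g(3)] k B.conj_mem[OF h(1)] B.funpow_mem[OF g(1)]
    by (simp add: rigid_stabilizer_def)
  moreover have "tree_conj ?h (g ^^ 4) \<noteq> id"
    using g(2) tree_conj_inj[OF h(2), of "g ^^ 4" id] tree_conj_eq_iff[OF h(2), of id id] by auto
  ultimately show ?thesis by blast
qed

theorem theorem3p8: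
  shows "saturated basilica2 \<and>
    conj_map basilica2 \<in> iso (as_group (normalizer AutT basilica2)) (AutoGroup (as_group basilica2))"
proof
  show "saturated basilica2"
    using basilica2_odometer_exists B.odometer_saturated by blast
  then show "conj_map basilica2 \<in> iso (as_group (normalizer AutT basilica2)) (AutoGroup (as_group basilica2))"
    using saturated_conj_map_iso basilica2_weakly_branch by blast
qed

end
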